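(* Let $\mathbf K=\mathbf H$ or $\mathbf K=\mathbf O$. Every quasicommutative $C^*$-algebra $\mathcal A$ over $\mathbf K$ is isometrically $*$-isomorphic to the algebra $C(\Lambda,\mathbf K)$ of all continuous $\mathbf K$-valued functions on its spectrum $\Lambda$.
   Context: $\mathbf H$ denotes the quaternions and $\mathbf O$ the octonions, regarded as real algebras with conjugation $z\mapsto\tilde z$, norm $|z|=(z\tilde z)^{1/2}$ and standard generators $i_0=1,i_1,\dots,i_m$, where $m=3$ for $\mathbf H$ and $m=7$ for $\mathbf O$. A $\mathbf K$-vector space $X$ is an additive group with left and right multiplication by scalars of $\mathbf K$, distributive on both sides, and with $a(bv)=(ab)v$, $(vb)a=v(ba)$ if $\mathbf K=\mathbf H$, respectively $b(bv)=b^2v$, $(vb)b=vb^2$ if $\mathbf K=\mathbf O$. It decomposes as $X=X_0\oplus X_1i_1\oplus\dots\oplus X_mi_m$ with $X_0,\dots,X_m$ pairwise isomorphic real vector spaces whose elements commute with scalars. It is a Banach space over $\mathbf K$ if it is complete in a norm with $\|av\|=|a|\,\|v\|=\|va\|$. A Banach algebra over $\mathbf K$ is a Banach space $\mathcal A$ over $\mathbf K$ which is also an algebra over $\mathbf K$ with unit $e$, $|e|=1$, $|xy|\le|x||y|$. An involution on it is a map $*$ with $(T^* )^*=T$, $(T+V)^*=T^*+V^*$, $(TV)^*=V^*T^*$, $(\alpha T)^*=T^*\tilde\alpha$ for $\alpha\in\mathbf K$. A $C^*$-algebra over $\mathbf K$ is a Banach algebra over $\mathbf K$ with involution such that $|x^*x|=|x|^2$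 for all $x$. It is quasicommutative if there is a commutative algebra $\mathcal A_0$ over $\mathbf R$ such that $\mathcal A$ is isomorphic with $\mathcal A_0\oplus\mathcal A_1i_1\oplus\dots\oplus\mathcal A_mi_m$, where the $\mathcal A_j$ are pairwise isomorphic real algebras. A $*$-isomorphism is a bijective algebra homomorphism preserving the involution. The spectrum (structural space) $\Lambda$ of $\mathcal A$ is the space of maximal (two-sided, proper) ideals $\mathcal M$ of $\mathcal A$, defined analogously to the complex Gelfand theory: using $\mathcal A/\mathcal M\cong\mathbf K$, each $x\in\mathcal A$ gives a function $x(\mathcal M)\in\mathbf K$ by $x+\mathcal M=x(\mathcal M)+\mathcal M$, and $\Lambda$ carries the weakest topology making all these functions continuous. $C(\Lambda,\mathbf K)$ has the supremum norm, pointwise operations and pointwise conjugation as involution.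
   Formalization: "Quasicommutative" is read as isomorphic with A_0+A_1 i_1+...+A_m i_m together with its involution, (xa)* = x ã for x in A_j; without this the claim fails, e.g. for the complex 2x2 matrices regarded as an algebra over H. *)

theory Defs
  imports "HOL-Analysis.Analysis"
begin

section \<open>Quaternions and octonions\<close>

text \<open>Both algebras are obtained by Cayley-Dickson doubling, as iterated pairs. The norm, the real
  vector space structure and the topology are those of the product types; the lemmas
  \<open>quaternion_norm\<close> and \<open>octonion_norm\<close> below show that this norm is \<open>(z z\<^sup>~)\<^sup>1\<^sup>/\<^sup>2\<close>.\<close>

type_synonym quaternion = "complex \<times> complex"
type_synonym octonion = "quaternion \<times> quaternion"

text \<open>The record field \<open>gen\<close> lists the standard generators \<open>i\<^sub>0 = 1, i\<^sub>1, \<dots>, i\<^sub>m\<close> (only the indices up to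
  \<open>m = last_gen\<close> matter).\<close>

record 'k scalars =
  smult :: "'k \<Rightarrow> 'k \<Rightarrow> 'k"
  sconj :: "'k \<Rightarrow> 'k"
  gen :: "nat \<Rightarrow> 'k"
  last_gen :: nat

definition qmult :: "quaternion \<Rightarrow> quaternion \<Rightarrow> quaternion" where
  "qmult x y = (case x of (a, b) \<Rightarrow> case y of (c, d) \<Rightarrow> (a * c - cnj d * b, d * a + b * cnj c))"

definition qconj :: "quaternion \<Rightarrow> quaternion" where
  "qconj x = (case x of (a, b) \<Rightarrow> (cnj a, - b))"

definition qgen :: "nat \<Rightarrow> quaternion" where
  "qgen j = [(1, 0), (\<i>, 0), (0, 1), (0, \<i>)] ! j"

definition Quat :: "quaternion scalars" where
  "Quat = \<lparr>smult = qmult, sconj = qconj, gen = qgen, last_gen = 3\<rparr>"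

definition omult :: "octonion \<Rightarrow> octonion \<Rightarrow> octonion" where
  "omult x y = (case x of (a, b) \<Rightarrow> case y of (c, d) \<Rightarrow>
     (qmult a c - qmult (qconj d) b, qmult d a + qmult b (qconj c)))"

definition oconj :: "octonion \<Rightarrow> octonion" where
  "oconj x = (case x of (a, b) \<Rightarrow> (qconj a, - b))"

definition ogen :: "nat \<Rightarrow> octonion" where
  "ogen j = (if j < 4 then (qgen j, 0) else (0, qgen (j - 4)))"

definition Oct :: "octonion scalars" where
  "Oct = \<lparr>smult = omult, sconj = oconj, gen = ogen, last_gen = 7\<rparr>"

lemma quaternion_norm: "qmult z (qconj z) = (norm z)\<^sup>2 *\<^sub>R qgen 0"
proof -
  obtain a b where z: "z = (a, b)" by fastforce
  have "(norm z)\<^sup>2 = (norm a)\<^sup>2 + (norm b)\<^sup>2"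
    by (simp add: z norm_Pair)
  then show ?thesis
    by (simp add: z qmult_def qconj_def qgen_def scaleR_conv_of_real mult.commute
        flip: complex_norm_square)
qed

lemma quaternion_norm': "qmult (qconj z) z = (norm z)\<^sup>2 *\<^sub>R qgen 0"
proof -
  obtain a b where z: "z = (a, b)" by fastforce
  have "(norm z)\<^sup>2 = (norm a)\<^sup>2 + (norm b)\<^sup>2"
    by (simp add: z norm_Pair)
  then show ?thesis
    by (simp add: z qmult_def qconj_def qgen_def scaleR_conv_of_real mult.commute
        flip: complex_norm_square)
qed

lemma octonion_norm: "omult z (oconj z) = (norm z)\<^sup>2 *\<^sub>R ogen 0"
proof -
  obtain a b where z: "z = (a, b)" by (cases z)
  have 1: "(norm z)\<^sup>2 = (norm a)\<^sup>2 + (norm b)\<^sup>2"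
    by (simp add: z norm_Pair)
  have 2: "qmult (qconj (- b)) b = - qmult (qconj b) b"
    "qmult b (qconj (qconj a)) = qmult b a" "qmult (- b) a = - qmult b a"
    by (auto simp: qmult_def qconj_def split: prod.splits)
  show ?thesis
    by (simp add: z omult_def oconj_def ogen_def 1[unfolded z] 2 quaternion_norm quaternion_norm'
        scaleR_add_left)
qed


section \<open>Banach spaces over the scalars\<close>

text \<open>The internal direct sum \<open>V = X\<^sub>0 \<oplus> X\<^sub>1 i\<^sub>1 \<oplus> \<dots> \<oplus> X\<^sub>m i\<^sub>m\<close> of real subspaces whose elements commute with
  scalars; \<open>lsc\<close> and \<open>rsc\<close> are left and right multiplication by scalars.\<close>

definition component_decomposition ::
  "('k, 'z) scalars_scheme \<Rightarrow> ('k \<Rightarrow> 'v::real_vector \<Rightarrow> 'v) \<Rightarrow> ('v \<Rightarrow> 'k \<Rightarrow> 'v) \<Rightarrow> (nat \<Rightarrow> 'v set) \<Rightarrow> bool"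
  where "component_decomposition K lsc rsc X \<longleftrightarrow>
    (\<forall>j\<le>last_gen K. subspace (X j) \<and> (\<forall>v\<in>X j. \<forall>a. lsc a v = rsc v a)) \<and>
    (\<forall>v. \<exists>!x. x \<in> (\<Pi>\<^sub>E j\<in>{..last_gen K}. X j) \<and> v = (\<Sum>j\<le>last_gen K. rsc (x j) (gen K j)))"

text \<open>The real vector space structure of the type is the one induced by the real scalars \<open>r i\<^sub>0\<close>.\<close>

locale scalar_vector_space =
  fixes K :: "'k::real_normed_vector scalars"
    and lsc :: "'k \<Rightarrow> 'v::real_vector \<Rightarrow> 'v" and rsc :: "'v \<Rightarrow> 'k \<Rightarrow> 'v"
  assumes lsc_add_scalar: "lsc (a + b) v = lsc a v + lsc b v"
    and lsc_add_vector: "lsc a (v + w) = lsc a v + lsc a w"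
    and rsc_add_scalar: "rsc v (a + b) = rsc v a + rsc v b"
    and rsc_add_vector: "rsc (v + w) a = rsc v a + rsc w a"
    and lsc_real: "lsc (r *\<^sub>R gen K 0) v = r *\<^sub>R v"
    and rsc_real: "rsc v (r *\<^sub>R gen K 0) = r *\<^sub>R v"
    and lsc_assoc: "last_gen K = 3 \<Longrightarrow> lsc a (lsc b v) = lsc (smult K a b) v"
    and rsc_assoc: "last_gen K = 3 \<Longrightarrow> rsc (rsc v b) a = rsc v (smult K b a)"
    and lsc_alternative: "last_gen K = 7 \<Longrightarrow> lsc b (lsc b v) = lsc (smult K b b) v"
    and rsc_alternative: "last_gen K = 7 \<Longrightarrow> rsc (rsc v b) b = rsc v (smult K b b)"
    and decomposition: "\<exists>X. component_decomposition K lsc rsc X \<and>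
      (\<forall>j\<le>last_gen K. \<forall>k\<le>last_gen K. \<exists>f. linear f \<and> bij_betw f (X j) (X k))"

locale scalar_banach_space = scalar_vector_space K lsc rsc
  for K :: "'k::real_normed_vector scalars"
    and lsc :: "'k \<Rightarrow> 'v::banach \<Rightarrow> 'v" and rsc :: "'v \<Rightarrow> 'k \<Rightarrow> 'v" +
  assumes norm_lsc: "norm (lsc a v) = norm a * norm v"
    and norm_rsc: "norm (rsc v a) = norm a * norm v"


section \<open>\<open>C\<^sup>*\<close>-algebras over the scalars\<close>

record ('k, 'a) star_algebra =
  lscale :: "'k \<Rightarrow> 'a \<Rightarrow> 'a"
  rscale :: "'a \<Rightarrow> 'k \<Rightarrow> 'a"
  amult :: "'a \<Rightarrow> 'a \<Rightarrow> 'a"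
  aunit :: 'a
  star :: "'a \<Rightarrow> 'a"

text \<open>Multiplication is associative over the quaternions and alternative over the octonions. A scalar
  \<open>a\<close> acts as multiplication by \<open>a e\<close>; over the quaternions this is equivalent to the usual
  \<open>a(xy) = (ax)y\<close>, \<open>(xa)y = x(ay)\<close>, \<open>(xy)a = x(ya)\<close>, which are not available over the octonions.\<close>

locale scalar_banach_algebra = scalar_banach_space K "lscale A" "rscale A"
  for K :: "'k::real_normed_vector scalars" and A :: "('k, 'a::banach) star_algebra" +
  assumes amult_add_left: "amult A (x + y) z = amult A x z + amult A y z"
    and amult_add_right: "amult A z (x + y) = amult A z x + amult A z y"
    and amult_scaleR_left: "amult A (r *\<^sub>R x) y = r *\<^sub>R amult A x y"
    and amult_scaleR_right: "amult A x (r *\<^sub>R y) = r *\<^sub>R amult A x y"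
    and amult_assoc: "last_gen K = 3 \<Longrightarrow> amult A (amult A x y) z = amult A x (amult A y z)"
    and amult_alternative_left: "last_gen K = 7 \<Longrightarrow> amult A x (amult A x y) = amult A (amult A x x) y"
    and amult_alternative_right: "last_gen K = 7 \<Longrightarrow> amult A (amult A y x) x = amult A y (amult A x x)"
    and unit_left: "amult A (aunit A) x = x"
    and unit_right: "amult A x (aunit A) = x"
    and lscale_eq: "lscale A a x = amult A (lscale A a (aunit A)) x"
    and rscale_eq: "rscale A x a = amult A x (lscale A a (aunit A))"
    and norm_unit: "norm (aunit A) = 1"
    and norm_amult: "norm (amult A x y) \<le> norm x * norm y"

locale scalar_cstar_algebra = scalar_banach_algebra K A
  for K :: "'k::real_normed_vector scalars" and A :: "('k, 'a::banach) star_algebra" +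
  assumes star_star: "star A (star A x) = x"
    and star_add: "star A (x + y) = star A x + star A y"
    and star_amult: "star A (amult A x y) = amult A (star A y) (star A x)"
    and star_lscale: "star A (lscale A a x) = rscale A (star A x) (sconj K a)"
    and cstar_identity: "norm (amult A (star A x) x) = (norm x)\<^sup>2"

definition real_subalgebra :: "('k, 'a::real_vector) star_algebra \<Rightarrow> 'a set \<Rightarrow> bool" where
  "real_subalgebra A S \<longleftrightarrow> subspace S \<and> aunit A \<in> S \<and> (\<forall>x\<in>S. \<forall>y\<in>S. amult A x y \<in> S)"

definition real_algebras_isomorphic ::
  "('k, 'a::real_vector) star_algebra \<Rightarrow> 'a set \<Rightarrow> 'a set \<Rightarrow> bool" where
  "real_algebras_isomorphic A S T \<longleftrightarrow>
    (\<exists>f. linear f \<and> bij_betw f S T \<and> f (aunit A) = aunit A \<and>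
      (\<forall>x\<in>S. \<forall>y\<in>S. f (amult A x y) = amult A (f x) (f y)))"

text \<open>\<open>A\<close> is identified with the algebra of sums \<open>x\<^sub>0 + x\<^sub>1 i\<^sub>1 + \<dots> + x\<^sub>m i\<^sub>m\<close>, where \<open>x\<^sub>j \<in> S\<^sub>j\<close>. The last two
  conditions say that \<open>A\<close> carries the product and the involution of that algebra:
  \<open>(x a)(y b) = (x y)(a b)\<close> and \<open>(x a)\<^sup>* = x a\<^sup>~\<close> for scalars \<open>a\<close>, \<open>b\<close>. The condition on the
  involution cannot be dropped: the complex 2 by 2 matrices, as the quaternions tensored with the
  real algebra of complex numbers, satisfy all the others, but have no quaternionic character.\<close>

definition quasicommutative ::
  "'k::real_normed_vector scalars \<Rightarrow> ('k, 'a::real_vector) star_algebra \<Rightarrow> bool" where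
  "quasicommutative K A \<longleftrightarrow> (\<exists>S.
    (\<forall>j\<le>last_gen K. real_subalgebra A (S j)) \<and>
    (\<forall>j\<le>last_gen K. \<forall>k\<le>last_gen K. real_algebras_isomorphic A (S j) (S k)) \<and>
    (\<forall>x\<in>S 0. \<forall>y\<in>S 0. amult A x y = amult A y x) \<and>
    (\<forall>x\<in>S 0. \<forall>y\<in>S 0. \<forall>z\<in>S 0. amult A (amult A x y) z = amult A x (amult A y z)) \<and>
    component_decomposition K (lscale A) (rscale A) S \<and>
    (\<forall>j\<le>last_gen K. \<forall>k\<le>last_gen K. \<forall>x\<in>S j. \<forall>y\<in>S k. \<forall>a b.
      amult A (rscale A x a) (rscale A y b) = rscale A (amult A x y) (smult K a b)) \<and>
    (\<forall>j\<le>last_gen K. \<forall>x\<in>S j. \<forall>a. star A (rscale A x a) = rscale A x (sconj K a)))"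


section \<open>The spectrum and the algebra of continuous functions\<close>

text \<open>Closure of ideals under scalars is automatic, as scalars act through multiples of the unit.\<close>

definition two_sided_ideal :: "('k, 'a::real_vector) star_algebra \<Rightarrow> 'a set \<Rightarrow> bool" where
  "two_sided_ideal A M \<longleftrightarrow> 0 \<in> M \<and> (\<forall>x\<in>M. \<forall>y\<in>M. x - y \<in> M) \<and>
    (\<forall>x\<in>M. \<forall>y. amult A x y \<in> M \<and> amult A y x \<in> M)"

definition maximal_ideals :: "('k, 'a::real_vector) star_algebra \<Rightarrow> 'a set set" where
  "maximal_ideals A = {M. two_sided_ideal A M \<and> M \<noteq> UNIV \<and>
    (\<forall>N. two_sided_ideal A N \<and> M \<subseteq> N \<longrightarrow> N = M \<or> N = UNIV)}"

text \<open>The value \<open>x(M)\<close>, the unique scalar with \<open>x + M = x(M) e + M\<close>.\<close>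

definition value_at :: "('k, 'a::real_vector) star_algebra \<Rightarrow> 'a \<Rightarrow> 'a set \<Rightarrow> 'k" where
  "value_at A x M = (THE k. x - lscale A k (aunit A) \<in> M)"

definition spectrum_topology ::
  "('k::real_normed_vector, 'a::real_vector) star_algebra \<Rightarrow> 'a set topology" where
  "spectrum_topology A =
    topology_generated_by {{M \<in> maximal_ideals A. value_at A x M \<in> U} | x U. open U}"

text \<open>Functions on the topological space \<open>T\<close> are represented by their extensions by \<open>undefined\<close>.\<close>

definition continuous_functions :: "'t topology \<Rightarrow> ('t \<Rightarrow> 'k::real_normed_vector) set" where
  "continuous_functions T = {f. continuous_map T euclidean f \<and> f \<in> extensional (topspace T)}"

definition isometrically_star_isomorphic_to_C ::
  "'k::real_normed_vector scalars \<Rightarrow> ('k, 'a::real_normed_vector) star_algebra \<Rightarrow> 't topology \<Rightarrow> bool"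
  where "isometrically_star_isomorphic_to_C K A T \<longleftrightarrow> (\<exists>\<phi>.
    bij_betw \<phi> UNIV (continuous_functions T) \<and>
    (\<forall>t\<in>topspace T.
      (\<forall>x y. \<phi> (x + y) t = \<phi> x t + \<phi> y t) \<and>
      (\<forall>a x. \<phi> (lscale A a x) t = smult K a (\<phi> x t)) \<and>
      (\<forall>a x. \<phi> (rscale A x a) t = smult K (\<phi> x t) a) \<and>
      (\<forall>x y. \<phi> (amult A x y) t = smult K (\<phi> x t) (\<phi> y t)) \<and>
      \<phi> (aunit A) t = gen K 0 \<and>
      (\<forall>x. \<phi> (star A x) t = sconj K (\<phi> x t))) \<and>
    (\<forall>x. bdd_above ((\<lambda>t. norm (\<phi> x t)) ` topspace T) \<and>
      norm x = (SUP t\<in>topspace T. norm (\<phi> x t))))"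

end

theory Submission
  imports Defs
begin

text \<open>Let \<open>B\<close> be the set of hermitian elements \<open>x = x\<^sup>*\<close> of the algebra. The involution acts on the summand
  \<open>S\<^sub>j i\<^sub>j\<close> of the quasicommutative decomposition through the scalar conjugation only, so \<open>B = S\<^sub>0\<close>
  (\<open>hermitian_structure\<close>): \<open>B\<close> is a commutative, associative, closed real subalgebra, and the whole
  algebra is \<open>B \<oplus> B i\<^sub>1 \<oplus> \<dots> \<oplus> B i\<^sub>m\<close>. The \<open>C\<^sup>*\<close>-identity for \<open>z = x + y i\<^sub>1\<close> with \<open>x, y \<in> B\<close> reads
  \<open>|x\<^sup>2 + y\<^sup>2| = |z|\<^sup>2\<close>, and \<open>x = (z + z\<^sup>*) / 2\<close> has norm at most \<open>|z|\<close>; hence \<open>B\<close> satisfies Arens' condition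
  \<open>|x|\<^sup>2 \<le> |x\<^sup>2 + y\<^sup>2|\<close>, which characterises the real algebras \<open>C(X, \<real>)\<close>.

  Arens' theorem is proved without spectral theory, by ordering \<open>B\<close>. A contraction argument shows that
  \<open>c e - x\<close> is a square whenever \<open>|x| < c\<close>. Together with Arens' condition this makes \<open>e + p\<close>
  invertible for every sum of squares \<open>p\<close>, so for a proper ideal \<open>J\<close> the sums of squares plus \<open>J\<close> form a
  convex multiplicative cone without \<open>-e\<close>. By Zorn's lemma this cone extends to a total ordering, and
  in a total ordering every \<open>x\<close> differs from exactly one real multiple of \<open>e\<close> by an infinitesimal;
  that real number is the value at \<open>x\<close> of a character vanishing on \<open>J\<close> (\<open>proper_ideal_character\<close>).
  Applied to the ideal generated by \<open>e - y\<^sup>2\<close> with \<open>|y| = 1\<close> it yields a character attaining the norm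
  (\<open>norm_attained\<close>). The characters form a compact set, so the Stone-Weierstrass theorem and
  completeness represent every continuous function on it (\<open>continuous_function_represented\<close>).

  A character \<open>\<phi>\<close> of \<open>B\<close> extends to the homomorphism \<open>\<Sum> x\<^sub>j i\<^sub>j \<mapsto> \<Sum> \<phi>(x\<^sub>j) i\<^sub>j\<close> into the scalars. For every \<open>x\<close>
  the element \<open>x\<^sup>* x\<close> lies in \<open>B\<close> and is sent to \<open>|x(\<phi>)|\<^sup>2\<close>. From this single fact it follows that the
  kernels of these extensions are precisely the maximal ideals and that the transform is isometric.
  Surjectivity is checked on each of the \<open>m + 1\<close> coordinates.\<close>

section \<open>Separation in function spaces\<close>


text \<open>Characters are compared in the product topology on functions. The Stone-Weierstrass theorem needs
  that topology to be Hausdorff.\<close>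
lemma open_coordinate_vimage: "open W \<Longrightarrow> open ((\<lambda>h. h i) -` W)"
  for W :: "'b::topological_space set" and i :: 'a
  using continuous_on_product_coordinates by (intro open_vimage)

instance "fun" :: (type, t0_space) t0_space
proof
  fix f g :: "'a \<Rightarrow> 'b" assume "f \<noteq> g"
  then obtain i where "f i \<noteq> g i" by blast
  then obtain U where U: "open U" "\<not> (f i \<in> U \<longleftrightarrow> g i \<in> U)"
    using separation_t0[of "f i" "g i"] by blast
  then show "\<exists>U. open U \<and> \<not> (f \<in> U \<longleftrightarrow> g \<in> U)"
    using open_coordinate_vimage[OF U(1), of i] by blast
qed

instance "fun" :: (type, t1_space) t1_space
proof
  fix f g :: "'a \<Rightarrow> 'b" assume "f \<noteq> g"
  then obtain i U where U: "open U" "f i \<in> U" "g i \<notin> U"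
    by (metis ext separation_t1)
  then show "\<exists>U. open U \<and> f \<in> U \<and> g \<notin> U"
    using open_coordinate_vimage[OF U(1), of i] by blast
qed

instance "fun" :: (type, t2_space) t2_space
proof
  fix f g :: "'a \<Rightarrow> 'b" assume "f \<noteq> g"
  then obtain i U V where UV: "open U" "open V" "f i \<in> U" "g i \<in> V" "U \<inter> V = {}"
    by (meson ext hausdorff)
  then show "\<exists>U V. open U \<and> open V \<and> f \<in> U \<and> g \<in> V \<and> U \<inter> V = {}"
    using open_coordinate_vimage[OF UV(1), of i] open_coordinate_vimage[OF UV(2), of i] by blast
qed


section \<open>Arens' theorem on real function algebras\<close>

text \<open>The algebra is carried by a closed subspace of a Banach space rather than by a type, because it
  will be the hermitian part of a larger, noncommutative algebra. The product is bilinear on the whole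
  space, whereas commutativity and associativity are only required on \<open>B\<close>.\<close>

locale arens_algebra =
  fixes B :: "'a::banach set" and mul :: "'a \<Rightarrow> 'a \<Rightarrow> 'a" (infixl "\<cdot>" 70) and e :: 'a
  assumes subspace: "subspace B" and closed: "closed B"
    and unit_mem [simp]: "e \<in> B" and mul_mem [simp]: "x \<in> B \<Longrightarrow> y \<in> B \<Longrightarrow> x \<cdot> y \<in> B"
    and add_left: "(x + y) \<cdot> z = x \<cdot> z + y \<cdot> z"
    and add_right: "z \<cdot> (x + y) = z \<cdot> x + z \<cdot> y"
    and scaleR_left: "(r *\<^sub>R x) \<cdot> y = r *\<^sub>R (x \<cdot> y)"
    and scaleR_right: "x \<cdot> (r *\<^sub>R y) = r *\<^sub>R (x \<cdot> y)"
    and commute: "x \<in> B \<Longrightarrow> y \<in> B \<Longrightarrow> x \<cdot> y = y \<cdot> x"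
    and assoc: "x \<in> B \<Longrightarrow> y \<in> B \<Longrightarrow> z \<in> B \<Longrightarrow> x \<cdot> y \<cdot> z = x \<cdot> (y \<cdot> z)"
    and unit [simp]: "x \<in> B \<Longrightarrow> e \<cdot> x = x"
    and norm_unit: "norm e = 1"
    and norm_mul: "norm (x \<cdot> y) \<le> norm x * norm y"
    and arens: "x \<in> B \<Longrightarrow> y \<in> B \<Longrightarrow> (norm x)\<^sup>2 \<le> norm (x \<cdot> x + y \<cdot> y)"
begin

sublocale mul: bounded_bilinear mul
  using norm_mul by unfold_locales (auto simp: add_left add_right scaleR_left scaleR_right intro!: exI[of _ 1])

lemmas bilinear = mul.add_left mul.add_right mul.diff_left mul.diff_right mul.scaleR_left
  mul.scaleR_right mul.minus_left mul.minus_right mul.zero_left mul.zero_right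

lemmas [simp] = subspace_0[OF subspace] subspace_add[OF subspace] subspace_diff[OF subspace]
  subspace_scale[OF subspace] subspace_neg[OF subspace]

lemma unit_right [simp]: "x \<in> B \<Longrightarrow> x \<cdot> e = x"
  by (simp add: commute[of x e])

lemma left_commute: "x \<in> B \<Longrightarrow> y \<in> B \<Longrightarrow> z \<in> B \<Longrightarrow> x \<cdot> (y \<cdot> z) = y \<cdot> (x \<cdot> z)"
  by (metis assoc commute)

lemmas ac = assoc commute left_commute

text \<open>Writing the root as \<open>e - w\<close> turns the equation into \<open>w = (u + w\<^sup>2) / 2\<close>, whose right-hand side
  contracts a ball of radius less than \<open>1\<close>.\<close>

lemma sqrt_unit_minus:
  assumes u: "u \<in> B" "norm u < 1"
  shows "\<exists>s\<in>B. s \<cdot> s = e - u"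
proof -
  \<comment> \<open>The smaller root of \<open>|u| + \<rho>\<^sup>2 = 2 \<rho>\<close>: the map takes the ball of radius \<open>\<rho>\<close> into itself, with Lipschitz constant \<open>\<rho>\<close>.\<close>
  define \<rho> where "\<rho> = 1 - sqrt (1 - norm u)"
  have \<rho>: "0 \<le> \<rho>" "\<rho> < 1" and fix_eq: "norm u + \<rho> * \<rho> = 2 * \<rho>"
    using u by (auto simp: \<rho>_def algebra_simps)
  define f where "f w = (1/2) *\<^sub>R (u + w \<cdot> w)" for w
  have "\<exists>!w\<in>B \<inter> cball 0 \<rho>. f w = w"
  proof (rule Banach_fix[OF _ _ \<rho>])
    show "complete (B \<inter> cball 0 \<rho>)"
      by (intro complete_eq_closed[THEN iffD2] closed_Int closed closed_cball)
    have "0 \<in> B \<inter> cball 0 \<rho>" using \<rho> by simp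
    then show "B \<inter> cball 0 \<rho> \<noteq> {}" by blast
    have "norm (f w) \<le> \<rho>" if "norm w \<le> \<rho>" for w
    proof -
      have "norm (u + w \<cdot> w) \<le> norm u + norm w * norm w"
        using norm_triangle_ineq[of u "w \<cdot> w"] norm_mul[of w w] by linarith
      also have "\<dots> \<le> norm u + \<rho> * \<rho>" using that \<rho> by (intro add_mono mult_mono) auto
      finally show ?thesis by (simp add: f_def fix_eq)
    qed
    then show "f ` (B \<inter> cball 0 \<rho>) \<subseteq> B \<inter> cball 0 \<rho>"
      using u by (auto simp: f_def)
    fix w w' assume w: "w \<in> B \<inter> cball 0 \<rho>" "w' \<in> B \<inter> cball 0 \<rho>"
    have "f w - f w' = (1/2) *\<^sub>R (w \<cdot> (w - w') + (w - w') \<cdot> w')"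
      by (simp add: f_def bilinear algebra_simps)
    then have "norm (f w - f w') = 1/2 * norm (w \<cdot> (w - w') + (w - w') \<cdot> w')"
      by simp
    also have "\<dots> \<le> 1/2 * (norm w * norm (w - w') + norm (w - w') * norm w')"
      by (intro mult_left_mono norm_triangle_le add_mono norm_mul) auto
    also have "\<dots> \<le> 1/2 * (\<rho> * norm (w - w') + norm (w - w') * \<rho>)"
      using w by (intro mult_left_mono add_mono mult_right_mono) auto
    finally show "dist (f w) (f w') \<le> \<rho> * dist w w'"
      by (simp add: dist_norm)
  qed
  then obtain w where w: "w \<in> B" "f w = w" by auto
  then have "u + w \<cdot> w = 2 *\<^sub>R w" by (metis f_def scaleR_2 scaleR_half_double scaleR_right_distrib)
  then have "(e - w) \<cdot> (e - w) = e - u"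
    using w u by (simp add: bilinear algebra_simps scaleR_2)
  then show ?thesis using w by (intro bexI[of _ "e - w"]) auto
qed

lemma sqrt_of_large:
  assumes x: "x \<in> B" "norm x < c"
  shows "\<exists>s\<in>B. s \<cdot> s = c *\<^sub>R e - x"
proof -
  have c: "c > 0" using x norm_ge_zero[of x] by linarith
  then obtain s where s: "s \<in> B" "s \<cdot> s = e - (1/c) *\<^sub>R x"
    using sqrt_unit_minus[of "(1/c) *\<^sub>R x"] x by (auto simp: divide_simps)
  show ?thesis
    using s c x by (intro bexI[of _ "sqrt c *\<^sub>R s"]) (auto simp: bilinear scaleR_diff_right)
qed

lemma inverse_of_large:
  assumes x: "x \<in> B" "norm x < c"
  shows "\<exists>w\<in>B. w \<cdot> (c *\<^sub>R e - x) = e"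
proof -
  have c: "c > 0" using x norm_ge_zero[of x] by linarith
  define f where "f w = (1/c) *\<^sub>R (e + x \<cdot> w)" for w
  have "\<exists>!w\<in>B. f w = w"
  proof (rule Banach_fix)
    show "complete B" "B \<noteq> {}"
      using complete_eq_closed closed unit_mem by (blast, blast)
    show "0 \<le> norm x / c" "norm x / c < 1" "f ` B \<subseteq> B"
      using x c by (auto simp: f_def)
    fix w w'
    have "norm (f w - f w') = norm (x \<cdot> (w - w')) / c"
      using c by (simp add: f_def bilinear flip: scaleR_diff_right)
    also have "\<dots> \<le> norm x * norm (w - w') / c"
      using c by (intro divide_right_mono norm_mul) auto
    finally show "dist (f w) (f w') \<le> norm x / c * dist w w'"
      by (simp add: dist_norm)
  qed
  then obtain w where w: "w \<in> B" "f w = w" by auto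
  have "c *\<^sub>R w = e + x \<cdot> w" using c by (subst w(2)[symmetric]) (simp add: f_def)
  then show ?thesis
    using w x by (intro bexI[of _ w]) (auto simp: bilinear commute[of w x])
qed


inductive_set sums_of_squares :: "'a set" where
  zero: "0 \<in> sums_of_squares"
| add_square: "x \<in> B \<Longrightarrow> p \<in> sums_of_squares \<Longrightarrow> x \<cdot> x + p \<in> sums_of_squares"

lemma sums_of_squares_mem: "p \<in> sums_of_squares \<Longrightarrow> p \<in> B"
  by (induction rule: sums_of_squares.induct) auto

lemma sums_of_squares_square: "x \<in> B \<Longrightarrow> x \<cdot> x \<in> sums_of_squares"
  using sums_of_squares.intros by fastforce

lemma sums_of_squares_add:
  "p \<in> sums_of_squares \<Longrightarrow> q \<in> sums_of_squares \<Longrightarrow> p + q \<in> sums_of_squares"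
  by (induction rule: sums_of_squares.induct) (auto simp: add.assoc intro: sums_of_squares.intros)

lemma sums_of_squares_mul:
  assumes "p \<in> sums_of_squares" "q \<in> sums_of_squares"
  shows "p \<cdot> q \<in> sums_of_squares"
  using assms(1)
proof (induction rule: sums_of_squares.induct)
  case zero
  then show ?case by (simp add: bilinear sums_of_squares.zero)
next
  case (add_square x p)
  from assms(2) have "x \<cdot> x \<cdot> q \<in> sums_of_squares"
  proof (induction rule: sums_of_squares.induct)
    case zero
    then show ?case by (simp add: bilinear sums_of_squares.zero)
  next
    case (add_square y q)
    have "x \<cdot> x \<cdot> (y \<cdot> y + q) = (x \<cdot> y) \<cdot> (x \<cdot> y) + x \<cdot> x \<cdot> q"
      using \<open>x \<in> B\<close> add_square sums_of_squares_mem by (simp add: bilinear ac)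
    then show ?case
      using \<open>x \<in> B\<close> add_square by (auto intro: sums_of_squares.intros)
  qed
  then show ?case using add_square by (simp add: bilinear sums_of_squares_add)
qed

text \<open>Squares are positive in the sense of the norm: for large \<open>c\<close> the element \<open>c e - x\<^sup>2\<close> is itself a
  square \<open>s\<^sup>2\<close>, and Arens' condition bounds \<open>|s\<^sup>2|\<close> by \<open>|s\<^sup>2 + x\<^sup>2| = c\<close>. Unlike the property of being a
  square, this bound is additive by the triangle inequality.\<close>

lemma square_in_ball:
  assumes x: "x \<in> B" and c: "norm (x \<cdot> x) < c"
  shows "norm (c *\<^sub>R e - x \<cdot> x) \<le> c"
proof -
  obtain s where s: "s \<in> B" "s \<cdot> s = c *\<^sub>R e - x \<cdot> x"
    using sqrt_of_large c x by (metis mul_mem)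
  have "c > 0" using c norm_ge_zero[of "x \<cdot> x"] by linarith
  have "norm (s \<cdot> s) \<le> (norm s)\<^sup>2" using norm_mul[of s s] by (simp add: power2_eq_square)
  also have "\<dots> \<le> norm (s \<cdot> s + x \<cdot> x)" by (rule arens[OF s(1) x])
  finally show ?thesis using s \<open>c > 0\<close> by (simp add: norm_unit)
qed

lemma sum_of_squares_in_ball:
  assumes "p \<in> sums_of_squares"
  shows "\<exists>c\<ge>0. norm (c *\<^sub>R e - p) \<le> c"
  using assms
proof (induction rule: sums_of_squares.induct)
  case zero
  then show ?case by (auto intro: exI[of _ 0])
next
  case (add_square x p)
  then obtain c where c: "c \<ge> 0" "norm (c *\<^sub>R e - p) \<le> c" by auto
  define d where "d = norm (x \<cdot> x) + 1"
  have "norm (d *\<^sub>R e - x \<cdot> x) \<le> d"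
    using add_square square_in_ball[of x d] by (simp add: d_def)
  then have "norm ((c + d) *\<^sub>R e - (x \<cdot> x + p)) \<le> c + d"
    using norm_triangle_ineq[of "c *\<^sub>R e - p" "d *\<^sub>R e - x \<cdot> x"] c
    by (simp add: algebra_simps)
  then show ?case using c by (intro exI[of _ "c + d"]) (auto simp: d_def)
qed

text \<open>With \<open>|c e - p| \<le> c\<close>, the element \<open>e + p = (1 + c) e - (c e - p)\<close> is a large multiple of the unit
  minus something of smaller norm.\<close>

lemma unit_plus_sum_of_squares_invertible:
  assumes p: "p \<in> sums_of_squares"
  shows "\<exists>w\<in>B. w \<cdot> (e + p) = e"
proof -
  obtain c where c: "c \<ge> 0" "norm (c *\<^sub>R e - p) \<le> c"
    using sum_of_squares_in_ball[OF p] by auto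
  obtain w where "w \<in> B" "w \<cdot> ((1 + c) *\<^sub>R e - (c *\<^sub>R e - p)) = e"
    using inverse_of_large[of "c *\<^sub>R e - p" "1 + c"] c sums_of_squares_mem[OF p] by auto
  then show ?thesis by (intro bexI[of _ w]) (auto simp: algebra_simps)
qed

text \<open>The preorderings of real algebra: cones of elements to be regarded as nonnegative, where squares are.\<close>

definition preorder_cone :: "'a set \<Rightarrow> bool" where
  "preorder_cone T \<longleftrightarrow> T \<subseteq> B \<and> (\<forall>x\<in>T. \<forall>y\<in>T. x + y \<in> T \<and> x \<cdot> y \<in> T) \<and>
    (\<forall>x\<in>B. x \<cdot> x \<in> T) \<and> - e \<notin> T"

lemma preorder_coneD:
  assumes "preorder_cone T"
  shows "x \<in> T \<Longrightarrow> x \<in> B" "x \<in> T \<Longrightarrow> y \<in> T \<Longrightarrow> x + y \<in> T" "x \<in> T \<Longrightarrow> y \<in> T \<Longrightarrow> x \<cdot> y \<in> T"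
    "x \<in> B \<Longrightarrow> x \<cdot> x \<in> T" "- e \<notin> T"
  using assms by (auto simp: preorder_cone_def)

lemma preorder_cone_unit: "preorder_cone T \<Longrightarrow> 0 \<in> T" "preorder_cone T \<Longrightarrow> e \<in> T"
  using preorder_coneD(4)[of T 0] preorder_coneD(4)[of T e] by (auto simp: bilinear)

text \<open>The least candidate containing \<open>T\<close> and \<open>x\<close> is \<open>T + x T\<close>; it is closed under products because \<open>x\<^sup>2\<close> is
  already in \<open>T\<close>.\<close>

lemma preorder_cone_adjoin:
  assumes T: "preorder_cone T" and x: "x \<in> B" and adj: "\<And>s t. s \<in> T \<Longrightarrow> t \<in> T \<Longrightarrow> s + x \<cdot> t \<noteq> - e"
  shows "\<exists>T'. preorder_cone T' \<and> T \<subseteq> T' \<and> x \<in> T'"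
proof -
  note D = preorder_coneD[OF T] and [simp] = preorder_cone_unit[OF T] and [simp] = preorder_coneD(1)[OF T]
  define T' where "T' = {s + x \<cdot> t | s t. s \<in> T \<and> t \<in> T}"
  have mem: "s + x \<cdot> t \<in> T'" if "s \<in> T" "t \<in> T" for s t using that by (auto simp: T'_def)
  have "T \<subseteq> T'"
    using mem[of _ 0] by (auto simp: bilinear)
  moreover have "x \<in> T'" using mem[of 0 e] x by simp
  moreover have "preorder_cone T'"
    unfolding preorder_cone_def
  proof (intro conjI ballI)
    show "T' \<subseteq> B" using D(1) x by (auto simp: T'_def)
    show "- e \<notin> T'" using adj by (force simp: T'_def)
    show "y \<cdot> y \<in> T'" if "y \<in> B" for y using D(4)[OF that] \<open>T \<subseteq> T'\<close> by blast
    fix y z assume "y \<in> T'" "z \<in> T'"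
    then obtain s t s' t' where yz: "y = s + x \<cdot> t" "z = s' + x \<cdot> t'" "s \<in> T" "t \<in> T" "s' \<in> T" "t' \<in> T"
      by (auto simp: T'_def)
    have "y + z = (s + s') + x \<cdot> (t + t')" by (simp add: yz bilinear)
    moreover have "\<dots> \<in> T'" by (intro mem D(2) yz)
    ultimately show "y + z \<in> T'" by simp
    have "y \<cdot> z = (s \<cdot> s' + (x \<cdot> x) \<cdot> (t \<cdot> t')) + x \<cdot> (s \<cdot> t' + t \<cdot> s')"
      using yz x by (simp add: bilinear ac)
    moreover have "\<dots> \<in> T'" by (intro mem D(2,3) D(4) x yz)
    ultimately show "y \<cdot> z \<in> T'" by simp
  qed
  ultimately show ?thesis by blast
qed

text \<open>A maximal cone \<open>T\<close> is total: if neither \<open>x\<close> nor \<open>-x\<close> could be adjoined, then \<open>s + x t = -e\<close> and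
  \<open>s' - x t' = -e\<close>, and multiplying the resulting expressions for \<open>x t\<close> and \<open>x t'\<close> exhibits \<open>-e\<close> as an
  element of \<open>T\<close>.\<close>

lemma preorder_cone_extends_to_ordering:
  assumes T0: "preorder_cone T0"
  shows "\<exists>T. preorder_cone T \<and> T0 \<subseteq> T \<and> (\<forall>x\<in>B. x \<in> T \<or> - x \<in> T)"
proof -
  define \<T> where "\<T> = {T. preorder_cone T \<and> T0 \<subseteq> T}"
  have "\<exists>T\<in>\<T>. \<forall>X\<in>\<T>. T \<subseteq> X \<longrightarrow> X = T"
  proof (rule subset_Zorn_nonempty)
    show "\<T> \<noteq> {}" using T0 by (auto simp: \<T>_def)
    fix \<C> assume ne: "\<C> \<noteq> {}" and "subset.chain \<T> \<C>"
    then have C: "\<And>T. T \<in> \<C> \<Longrightarrow> preorder_cone T \<and> T0 \<subseteq> T"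
      and chain: "\<And>T T'. T \<in> \<C> \<Longrightarrow> T' \<in> \<C> \<Longrightarrow> T \<subseteq> T' \<or> T' \<subseteq> T"
      by (auto simp: subset_chain_def \<T>_def)
    have "x + y \<in> \<Union>\<C> \<and> x \<cdot> y \<in> \<Union>\<C>" if xy: "x \<in> \<Union>\<C>" "y \<in> \<Union>\<C>" for x y
    proof -
      obtain T where "T \<in> \<C>" "x \<in> T" "y \<in> T" using xy chain by blast
      then show ?thesis using C[of T] preorder_coneD(2,3)[of T x y] by blast
    qed
    then have "preorder_cone (\<Union>\<C>)"
      unfolding preorder_cone_def using C ne preorder_coneD(1,4,5) by (intro conjI ballI) blast+
    then show "\<Union>\<C> \<in> \<T>" using C ne by (auto simp: \<T>_def)
  qed
  then obtain T where T: "preorder_cone T" "T0 \<subseteq> T"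
    and max: "\<And>X. preorder_cone X \<Longrightarrow> T \<subseteq> X \<Longrightarrow> X = T"
    by (force simp: \<T>_def)
  note D = preorder_coneD[OF T(1)] and [simp] = preorder_cone_unit[OF T(1)] and [simp] = preorder_coneD(1)[OF T(1)]
  have "x \<in> T \<or> - x \<in> T" if x: "x \<in> B" for x
  proof (rule ccontr)
    assume not: "\<not> (x \<in> T \<or> - x \<in> T)"
    obtain s t where st: "s \<in> T" "t \<in> T" "s + x \<cdot> t = - e"
      using preorder_cone_adjoin[OF T(1) x] max not by metis
    obtain s' t' where st': "s' \<in> T" "t' \<in> T" "s' + (- x) \<cdot> t' = - e"
      using preorder_cone_adjoin[OF T(1), of "- x"] x max not by (metis subspace_neg[OF subspace])
    have 1: "x \<cdot> t = - (e + s)" "x \<cdot> t' = e + s'"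
      using st(3) st'(3) by (auto simp: bilinear algebra_simps eq_neg_iff_add_eq_0)
    have "(x \<cdot> x) \<cdot> (t \<cdot> t') = (x \<cdot> t) \<cdot> (x \<cdot> t')"
      using x st st' by (simp add: ac)
    also have "\<dots> = - e - (s + s' + s \<cdot> s')"
      using st st' by (simp add: 1 bilinear algebra_simps)
    finally have "- e = (x \<cdot> x) \<cdot> (t \<cdot> t') + (s + s' + s \<cdot> s')" by simp
    also have "\<dots> \<in> T" using st st' D(2,3) D(4)[OF x] by presburger
    finally show False using D(5) by blast
  qed
  then show ?thesis using T by blast
qed

text \<open>The value \<open>0\<close> outside \<open>B\<close> makes a character determined by its restriction to \<open>B\<close>, so that
  distinct characters are separated by elements of \<open>B\<close>.\<close>

definition characters :: "('a \<Rightarrow> real) set" where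
  "characters = {\<phi>. (\<forall>x\<in>B. \<forall>y\<in>B. \<phi> (x + y) = \<phi> x + \<phi> y \<and> \<phi> (x \<cdot> y) = \<phi> x * \<phi> y) \<and>
    (\<forall>x\<in>B. \<forall>r. \<phi> (r *\<^sub>R x) = r * \<phi> x) \<and> \<phi> e = 1 \<and> (\<forall>x. x \<notin> B \<longrightarrow> \<phi> x = 0)}"

lemma characterD:
  assumes "\<phi> \<in> characters"
  shows "x \<in> B \<Longrightarrow> y \<in> B \<Longrightarrow> \<phi> (x + y) = \<phi> x + \<phi> y" "x \<in> B \<Longrightarrow> y \<in> B \<Longrightarrow> \<phi> (x \<cdot> y) = \<phi> x * \<phi> y"
    "x \<in> B \<Longrightarrow> \<phi> (r *\<^sub>R x) = r * \<phi> x" "\<phi> e = 1" "x \<notin> B \<Longrightarrow> \<phi> x = 0"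
    "x \<in> B \<Longrightarrow> y \<in> B \<Longrightarrow> \<phi> (x - y) = \<phi> x - \<phi> y" "\<phi> 0 = 0"
proof -
  show 1: "x \<in> B \<Longrightarrow> y \<in> B \<Longrightarrow> \<phi> (x + y) = \<phi> x + \<phi> y" "x \<in> B \<Longrightarrow> y \<in> B \<Longrightarrow> \<phi> (x \<cdot> y) = \<phi> x * \<phi> y"
    "x \<in> B \<Longrightarrow> \<phi> (r *\<^sub>R x) = r * \<phi> x" "\<phi> e = 1" "x \<notin> B \<Longrightarrow> \<phi> x = 0" for x y r
    using assms by (auto simp: characters_def)
  show "x \<in> B \<Longrightarrow> y \<in> B \<Longrightarrow> \<phi> (x - y) = \<phi> x - \<phi> y"
    using 1(1)[of "x - y" y] by simp
  show "\<phi> 0 = 0" using 1(3)[of e 0] by simp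
qed

text \<open>In a total ordering every element is bounded by multiples of the unit, because \<open>c e - x\<close> is a
  square for \<open>c > |x|\<close>. So \<open>x\<close> determines a Dedekind cut in the reals, and it differs from the cut point
  by an infinitesimal. The infinitesimals form an ideal, which is the kernel of the character.\<close>

lemma ordering_character:
  assumes T: "preorder_cone T" and total: "\<And>x. x \<in> B \<Longrightarrow> x \<in> T \<or> - x \<in> T"
  shows "\<exists>\<phi>\<in>characters. \<forall>x\<in>T. \<phi> x \<ge> 0"
proof -
  note D = preorder_coneD[OF T] and [simp] = preorder_cone_unit[OF T]
  have pos: "r *\<^sub>R e \<in> T" if "r \<ge> 0" for r
    using D(4)[of "sqrt r *\<^sub>R e"] that by (simp add: bilinear)
  have scale: "r *\<^sub>R x \<in> T" if "r \<ge> 0" "x \<in> T" for r x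
    using D(3)[OF pos[OF that(1)] that(2)] D(1)[OF that(2)] by (simp add: bilinear)
  have pos_iff: "r *\<^sub>R e \<in> T \<longleftrightarrow> r \<ge> 0" for r
  proof
    assume r: "r *\<^sub>R e \<in> T"
    show "r \<ge> 0"
    proof (rule ccontr)
      assume "\<not> r \<ge> 0"
      then have "- e = (1 / - r) *\<^sub>R (r *\<^sub>R e)" by simp
      also have "\<dots> \<in> T" using \<open>\<not> r \<ge> 0\<close> by (intro scale[OF _ r]) simp
      finally show False using D(5) by simp
    qed
  qed (rule pos)
  have large: "c *\<^sub>R e - x \<in> T" if "x \<in> B" "norm x < c" for x c
    using sqrt_of_large[OF that] D(4) by metis
  have large': "c *\<^sub>R e + x \<in> T" if "x \<in> B" "norm x < c" for x c
    using large[of "- x" c] that by simp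

  \<comment> \<open>The ideal of infinitesimals.\<close>
  define N where "N = {x \<in> B. \<forall>\<epsilon>>0. \<epsilon> *\<^sub>R e + x \<in> T \<and> \<epsilon> *\<^sub>R e - x \<in> T}"
  have N_add: "x + y \<in> N" if "x \<in> N" "y \<in> N" for x y
  proof -
    have "\<epsilon> *\<^sub>R e + (x + y) \<in> T" "\<epsilon> *\<^sub>R e - (x + y) \<in> T" if "\<epsilon> > 0" for \<epsilon>
    proof -
      have "((\<epsilon>/2) *\<^sub>R e + x) + ((\<epsilon>/2) *\<^sub>R e + y) \<in> T" "((\<epsilon>/2) *\<^sub>R e - x) + ((\<epsilon>/2) *\<^sub>R e - y) \<in> T"
        using \<open>x \<in> N\<close> \<open>y \<in> N\<close> that by (simp_all add: N_def D(2))
      moreover have "((\<epsilon>/2) *\<^sub>R e + x) + ((\<epsilon>/2) *\<^sub>R e + y) = \<epsilon> *\<^sub>R e + (x + y)"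
        "((\<epsilon>/2) *\<^sub>R e - x) + ((\<epsilon>/2) *\<^sub>R e - y) = \<epsilon> *\<^sub>R e - (x + y)"
        by (simp_all add: algebra_simps flip: scaleR_add_left)
      ultimately show "\<epsilon> *\<^sub>R e + (x + y) \<in> T" "\<epsilon> *\<^sub>R e - (x + y) \<in> T" by simp_all
    qed
    then show ?thesis using that by (auto simp: N_def)
  qed
  have N_mul: "x \<cdot> y \<in> N" if x: "x \<in> N" and y: "y \<in> B" for x y
  proof -
    have xB: "x \<in> B" using x by (simp add: N_def)
    define c where "c = norm y + 1"
    have c: "c > 0" by (simp add: c_def add_nonneg_pos)
    have "\<epsilon> *\<^sub>R e + x \<cdot> y \<in> T \<and> \<epsilon> *\<^sub>R e - x \<cdot> y \<in> T" if \<epsilon>: "\<epsilon> > 0" for \<epsilon>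
    proof -
      define \<delta> where "\<delta> = \<epsilon> / c"
      have \<delta>: "\<delta> *\<^sub>R e + x \<in> T" "\<delta> *\<^sub>R e - x \<in> T"
        using x \<epsilon> c by (auto simp: N_def \<delta>_def)
      have cy: "c *\<^sub>R e + y \<in> T" "c *\<^sub>R e - y \<in> T"
        using large large' y by (auto simp: c_def)
      \<comment> \<open>Both factors of each product are nonnegative, and the mixed terms cancel in each sum.\<close>
      have "(\<delta> *\<^sub>R e + x) \<cdot> (c *\<^sub>R e + y) + (\<delta> *\<^sub>R e - x) \<cdot> (c *\<^sub>R e - y) \<in> T"
        "(\<delta> *\<^sub>R e + x) \<cdot> (c *\<^sub>R e - y) + (\<delta> *\<^sub>R e - x) \<cdot> (c *\<^sub>R e + y) \<in> T"
        using \<delta> cy D(2,3) by presburger+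
      moreover have double: "\<epsilon> *\<^sub>R e + \<epsilon> *\<^sub>R e = (\<epsilon> * 2) *\<^sub>R e"
        by (simp flip: scaleR_add_left)
      moreover have "(\<delta> *\<^sub>R e + x) \<cdot> (c *\<^sub>R e + y) + (\<delta> *\<^sub>R e - x) \<cdot> (c *\<^sub>R e - y) = 2 *\<^sub>R (\<epsilon> *\<^sub>R e + x \<cdot> y)"
        "(\<delta> *\<^sub>R e + x) \<cdot> (c *\<^sub>R e - y) + (\<delta> *\<^sub>R e - x) \<cdot> (c *\<^sub>R e + y) = 2 *\<^sub>R (\<epsilon> *\<^sub>R e - x \<cdot> y)"
        using xB y c double by (auto simp: bilinear algebra_simps \<delta>_def scaleR_2)
      ultimately show ?thesis using scale[of "1/2" "2 *\<^sub>R (\<epsilon> *\<^sub>R e + x \<cdot> y)"]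
          scale[of "1/2" "2 *\<^sub>R (\<epsilon> *\<^sub>R e - x \<cdot> y)"] by simp
    qed
    then show ?thesis using xB y by (auto simp: N_def)
  qed
  have N_mul': "y \<cdot> x \<in> N" if "x \<in> N" "y \<in> B" for x y
    using N_mul[OF that] that commute[of x y] by (simp add: N_def)
  have N_scale: "r *\<^sub>R x \<in> N" if "x \<in> N" for r x
    using N_mul[OF that, of "r *\<^sub>R e"] that by (simp add: bilinear N_def)
  have N_unit: "r = 0" if "r *\<^sub>R e \<in> N" for r
  proof -
    have "\<epsilon> + r \<ge> 0 \<and> \<epsilon> - r \<ge> 0" if "\<epsilon> > 0" for \<epsilon>
      using \<open>r *\<^sub>R e \<in> N\<close> that pos_iff[of "\<epsilon> + r"] pos_iff[of "\<epsilon> - r"]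
      by (auto simp: N_def scaleR_add_left scaleR_diff_left)
    then have "\<bar>r\<bar> \<le> 0 + \<epsilon>" if "\<epsilon> > 0" for \<epsilon> using that by force
    then have "\<bar>r\<bar> \<le> 0" by (rule field_le_epsilon)
    then show ?thesis by simp
  qed
  have ex: "\<exists>r. x - r *\<^sub>R e \<in> N" if x: "x \<in> B" for x
  proof -
    define L where "L = {t. x - t *\<^sub>R e \<in> T}"
    have bdd: "t \<le> norm x + 1" if "t \<in> L" for t
    proof -
      have "(x - t *\<^sub>R e) + ((norm x + 1) *\<^sub>R e - x) \<in> T"
        using that large[OF x, of "norm x + 1"] by (intro D(2)) (auto simp: L_def)
      then have "(norm x + 1 - t) *\<^sub>R e \<in> T" by (simp add: algebra_simps)
      then show ?thesis using pos_iff by simp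
    qed
    have ne: "- (norm x + 1) \<in> L"
      using large'[OF x, of "norm x + 1"] by (simp add: L_def algebra_simps)
    have "\<epsilon> *\<^sub>R e + (x - Sup L *\<^sub>R e) \<in> T \<and> \<epsilon> *\<^sub>R e - (x - Sup L *\<^sub>R e) \<in> T" if "\<epsilon> > 0" for \<epsilon>
    proof
      obtain t where t: "t \<in> L" "Sup L - \<epsilon> < t"
        using less_cSupD[of L "Sup L - \<epsilon>"] ne \<open>\<epsilon> > 0\<close> by force
      have "(x - t *\<^sub>R e) + (t - (Sup L - \<epsilon>)) *\<^sub>R e \<in> T"
        using t pos by (intro D(2)) (auto simp: L_def)
      then show "\<epsilon> *\<^sub>R e + (x - Sup L *\<^sub>R e) \<in> T" by (simp add: algebra_simps)
      have "Sup L + \<epsilon> \<notin> L"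
        using cSup_upper[of "Sup L + \<epsilon>" L] bdd that by (meson add_le_same_cancel1 bdd_above.I not_less)
      then have "x - (Sup L + \<epsilon>) *\<^sub>R e \<notin> T" by (simp add: L_def)
      then have "- (x - (Sup L + \<epsilon>) *\<^sub>R e) \<in> T" using total x by (meson subspace_diff[OF subspace] subspace_scale[OF subspace] unit_mem)
      then show "\<epsilon> *\<^sub>R e - (x - Sup L *\<^sub>R e) \<in> T" by (simp add: algebra_simps)
    qed
    then show ?thesis using x by (auto simp: N_def)
  qed
  define \<phi> where "\<phi> x = (if x \<in> B then SOME r. x - r *\<^sub>R e \<in> N else 0)" for x
  have \<phi>: "x - \<phi> x *\<^sub>R e \<in> N" if "x \<in> B" for x
    using someI_ex[OF ex[OF that]] that by (simp add: \<phi>_def)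
  have \<phi>_eq: "\<phi> x = r" if "x - r *\<^sub>R e \<in> N" for x r
  proof -
    have "x \<in> B" using subspace_add[OF subspace, of "x - r *\<^sub>R e" "r *\<^sub>R e"] that by (simp add: N_def)
    have "(x - r *\<^sub>R e) + (-1) *\<^sub>R (x - \<phi> x *\<^sub>R e) \<in> N"
      using that \<phi>[OF \<open>x \<in> B\<close>] by (intro N_add N_scale)
    then have "(\<phi> x - r) *\<^sub>R e \<in> N" by (simp add: algebra_simps)
    then show ?thesis using N_unit by fastforce
  qed
  have "\<phi> \<in> characters"
    unfolding characters_def
  proof (intro CollectI conjI ballI allI impI)
    fix x y r assume x: "x \<in> B"
    have "r *\<^sub>R x - (r * \<phi> x) *\<^sub>R e = r *\<^sub>R (x - \<phi> x *\<^sub>R e)" by (simp add: algebra_simps)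
    then show "\<phi> (r *\<^sub>R x) = r * \<phi> x" using \<phi>_eq N_scale \<phi>[OF x] by metis
    assume y: "y \<in> B"
    have "x + y - (\<phi> x + \<phi> y) *\<^sub>R e = (x - \<phi> x *\<^sub>R e) + (y - \<phi> y *\<^sub>R e)" by (simp add: algebra_simps)
    then show "\<phi> (x + y) = \<phi> x + \<phi> y" using \<phi>_eq N_add \<phi>[OF x] \<phi>[OF y] by metis
    have "x \<cdot> y - (\<phi> x * \<phi> y) *\<^sub>R e = (x - \<phi> x *\<^sub>R e) \<cdot> y + \<phi> x *\<^sub>R (y - \<phi> y *\<^sub>R e)"
      using x y by (simp add: bilinear algebra_simps)
    then show "\<phi> (x \<cdot> y) = \<phi> x * \<phi> y"
      using \<phi>_eq N_add[OF N_mul[OF \<phi>[OF x] y] N_scale[OF \<phi>[OF y]]] by metis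
  next
    have "e - 1 *\<^sub>R e \<in> N" by (simp add: N_def pos)
    then show "\<phi> e = 1" by (rule \<phi>_eq)
  qed (simp add: \<phi>_def)
  moreover have "\<phi> x \<ge> 0" if x: "x \<in> T" for x
  proof (rule ccontr)
    assume neg: "\<not> \<phi> x \<ge> 0"
    have "(- (\<phi> x / 2)) *\<^sub>R e - (x - \<phi> x *\<^sub>R e) \<in> T"
      using neg \<phi>[OF D(1)[OF x]] by (simp only: N_def mem_Collect_eq)
    moreover have "\<phi> x *\<^sub>R e = (\<phi> x / 2) *\<^sub>R e + (\<phi> x / 2) *\<^sub>R e"
      by (simp flip: scaleR_add_left)
    ultimately have "(\<phi> x / 2) *\<^sub>R e - x \<in> T" by simp
    from D(2)[OF this x] have "(\<phi> x / 2) *\<^sub>R e \<in> T" by simp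
    then show False using neg pos_iff by simp
  qed
  ultimately show ?thesis by blast
qed

definition ideal :: "'a set \<Rightarrow> bool" where
  "ideal J \<longleftrightarrow> J \<subseteq> B \<and> 0 \<in> J \<and> (\<forall>x\<in>J. \<forall>y\<in>J. x - y \<in> J) \<and> (\<forall>x\<in>J. \<forall>y\<in>B. y \<cdot> x \<in> J)"

text \<open>The cone of sums of squares plus \<open>J\<close> does not contain \<open>-e\<close>, since otherwise the invertible
  element \<open>e + p\<close> would lie in \<open>J\<close>. A character that is nonnegative on this cone vanishes on \<open>J = -J\<close>.\<close>

lemma proper_ideal_character:
  assumes J: "ideal J" and proper: "e \<notin> J"
  shows "\<exists>\<phi>\<in>characters. \<forall>x\<in>J. \<phi> x = 0"
proof -
  have J_mem: "x \<in> J \<Longrightarrow> x \<in> B" and J0: "0 \<in> J"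
    and J_diff: "x \<in> J \<Longrightarrow> y \<in> J \<Longrightarrow> x - y \<in> J" and J_mul: "x \<in> J \<Longrightarrow> y \<in> B \<Longrightarrow> y \<cdot> x \<in> J" for x y
    using J by (auto simp: ideal_def)
  have J_neg: "x \<in> J \<Longrightarrow> - x \<in> J" for x using J_diff[OF J0] by fastforce
  have J_add: "x \<in> J \<Longrightarrow> y \<in> J \<Longrightarrow> x + y \<in> J" for x y
    using J_diff[OF _ J_neg] by fastforce
  define T where "T = {p + j | p j. p \<in> sums_of_squares \<and> j \<in> J}"
  have mem: "p + j \<in> T" if "p \<in> sums_of_squares" "j \<in> J" for p j using that by (auto simp: T_def)
  have "preorder_cone T"
    unfolding preorder_cone_def
  proof (intro conjI ballI)
    show "T \<subseteq> B" using J_mem sums_of_squares_mem by (auto simp: T_def)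
    show "x \<cdot> x \<in> T" if "x \<in> B" for x using mem[OF sums_of_squares_square[OF that] J0] by simp
    show "- e \<notin> T"
    proof
      assume "- e \<in> T"
      then obtain p j where pj: "- e = p + j" "p \<in> sums_of_squares" "j \<in> J" by (auto simp: T_def)
      then have "e + p = - j"
        by (metis add.commute add_diff_cancel_left' diff_minus_eq_add group_cancel.neg1
            minus_add_cancel minus_diff_eq neg_equal_iff_equal)
      moreover obtain w where "w \<in> B" "w \<cdot> (e + p) = e"
        using unit_plus_sum_of_squares_invertible[OF pj(2)] by blast
      ultimately show False using proper J_mul[OF J_neg[OF pj(3)]] by metis
    qed
    fix x y assume "x \<in> T" "y \<in> T"
    then obtain p j q k where xy: "x = p + j" "y = q + k" "p \<in> sums_of_squares" "j \<in> J"
      "q \<in> sums_of_squares" "k \<in> J" by (auto simp: T_def)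
    have "x + y = (p + q) + (j + k)" by (simp add: xy)
    moreover have "\<dots> \<in> T" by (intro mem sums_of_squares_add J_add xy)
    ultimately show "x + y \<in> T" by simp
    have "x \<cdot> y = p \<cdot> q + (p \<cdot> k + (q \<cdot> j + k \<cdot> j))"
      using xy J_mem sums_of_squares_mem by (simp add: bilinear commute)
    then show "x \<cdot> y \<in> T"
      using mem[OF sums_of_squares_mul J_add[OF J_mul J_add[OF J_mul J_mul]]] xy J_mem sums_of_squares_mem
      by metis
  qed
  then obtain T' where "preorder_cone T'" "T \<subseteq> T'" "\<forall>x\<in>B. x \<in> T' \<or> - x \<in> T'"
    using preorder_cone_extends_to_ordering by blast
  then obtain \<phi> where \<phi>: "\<phi> \<in> characters" "\<And>x. x \<in> T \<Longrightarrow> \<phi> x \<ge> 0"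
    using ordering_character[of T'] by blast
  have "\<phi> x = 0" if x: "x \<in> J" for x
  proof -
    have "\<phi> x \<ge> 0" using \<phi>(2)[OF mem[OF sums_of_squares.zero x]] by simp
    moreover have "\<phi> (- x) \<ge> 0" using \<phi>(2)[OF mem[OF sums_of_squares.zero J_neg[OF x]]] by simp
    moreover have "\<phi> (- x) = - \<phi> x" using characterD(3)[OF \<phi>(1) J_mem[OF x], of "-1"] by simp
    ultimately show ?thesis by simp
  qed
  then show ?thesis using \<phi>(1) by blast
qed

text \<open>Continuity is automatic: \<open>c e - x\<close> is a square for \<open>c > |x|\<close>, and characters take squares to
  nonnegative numbers.\<close>

lemma character_bound:
  assumes \<phi>: "\<phi> \<in> characters"
  shows "\<bar>\<phi> x\<bar> \<le> norm x"
proof (cases "x \<in> B")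
  case True
  have bound: "\<phi> y \<le> norm y" if y: "y \<in> B" for y
  proof (rule field_le_epsilon)
    fix \<epsilon> :: real assume "\<epsilon> > 0"
    then obtain s where s: "s \<in> B" "s \<cdot> s = (norm y + \<epsilon>) *\<^sub>R e - y"
      using sqrt_of_large[OF y, of "norm y + \<epsilon>"] by auto
    have "0 \<le> \<phi> (s \<cdot> s)" using characterD(2)[OF \<phi> s(1) s(1)] by simp
    also have "\<dots> = norm y + \<epsilon> - \<phi> y" using y by (simp add: s characterD[OF \<phi>])
    finally show "\<phi> y \<le> norm y + \<epsilon>" by simp
  qed
  show ?thesis
    using bound[OF True] bound[of "(-1) *\<^sub>R x"] True characterD(3)[OF \<phi> True, of "-1"] by simp
qed (simp add: characterD[OF \<phi>])

text \<open>If \<open>a = x\<^sup>2\<close> and \<open>e - a\<close> had an inverse \<open>b\<close>, then \<open>e - a\<close> would be bounded below by some \<open>\<delta> e\<close>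
  in the order, so \<open>(1 - \<delta>) e\<close> would be \<open>x\<^sup>2\<close> plus a square, and Arens' condition would give
  \<open>|x|\<^sup>2 \<le> 1 - \<delta>\<close>. As \<open>|a|\<close> may equal \<open>1\<close>, only \<open>(1 + \<epsilon>) e - a\<close> is known to be a square. So the
  argument is carried out up to an error of order \<open>\<epsilon>\<close>.\<close>

lemma unit_minus_square_not_invertible:
  assumes x: "x \<in> B" "norm x = 1" and b: "b \<in> B" "b \<cdot> (e - x \<cdot> x) = e"
  shows False
proof -
  \<comment> \<open>\<open>d\<close> will bound \<open>|c|\<close> from above, which makes \<open>\<delta>\<close> small enough for \<open>e - \<delta> c\<close> to have a root.\<close>
  define d where "d = (1 + norm b)\<^sup>2"
  define \<delta> where "\<delta> = 1 / (2 * d)"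
  define \<epsilon> where "\<epsilon> = \<delta> / 4"
  define a where "a = x \<cdot> x"
  have aB: "a \<in> B" using x by (simp add: a_def)
  have "d \<ge> 1" by (simp add: d_def)
  then have \<delta>: "\<delta> > 0" "\<delta> \<le> 1/2" and \<delta>d: "\<delta> * d = 1/2"
    by (auto simp: \<delta>_def divide_simps)
  have \<epsilon>: "\<epsilon> > 0" "\<epsilon> \<le> 1" using \<delta> by (auto simp: \<epsilon>_def)
  have "norm a \<le> 1" using norm_mul[of x x] x by (simp add: a_def)
  then obtain s where s: "s \<in> B" "s \<cdot> s = (1 + \<epsilon>) *\<^sub>R e - a"
    using sqrt_of_large[OF aB, of "1 + \<epsilon>"] \<epsilon> by auto
  \<comment> \<open>\<open>c = s\<^sup>2 b\<^sup>2\<close>, so that \<open>s\<^sup>2 c = e\<close> up to order \<open>\<epsilon>\<close> and \<open>s\<^sup>2 (e - \<delta> c)\<close> is nearly \<open>e - a - \<delta> e\<close>.\<close>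
  define c where "c = b + \<epsilon> *\<^sub>R (b \<cdot> b)"
  have cB: "c \<in> B" using b by (simp add: c_def)
  have "norm c \<le> norm b + \<epsilon> * (norm b * norm b)"
    unfolding c_def using norm_mul[of b b] \<epsilon> by (intro norm_triangle_le add_mono) auto
  also have "\<dots> \<le> norm b + 1 * (norm b * norm b)"
    using \<epsilon> by (intro add_mono mult_right_mono) auto
  also have "\<dots> \<le> d" by (simp add: d_def power2_eq_square algebra_simps)
  finally have cn: "norm c \<le> d" .
  then have \<delta>c: "\<delta> * norm c \<le> 1/2" using \<delta>d \<delta> by (metis mult_le_cancel_left_pos)
  then obtain t where t: "t \<in> B" "t \<cdot> t = e - \<delta> *\<^sub>R c"
    using sqrt_unit_minus[of "\<delta> *\<^sub>R c"] cB \<delta> by auto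
  have ba: "b \<cdot> a = b - e" using b x aB by (simp add: bilinear a_def[symmetric] algebra_simps)
  have bba: "b \<cdot> (b \<cdot> a) = b \<cdot> b - b" using b by (simp add: ba bilinear)
  have "(s \<cdot> s) \<cdot> c = e + \<epsilon> *\<^sub>R (2 *\<^sub>R b + \<epsilon> *\<^sub>R (b \<cdot> b))"
  proof -
    have "a \<cdot> c = b \<cdot> a + \<epsilon> *\<^sub>R (b \<cdot> (b \<cdot> a))"
      using aB b by (simp add: c_def bilinear ac)
    then have "a \<cdot> c = b - e + \<epsilon> *\<^sub>R (b \<cdot> b - b)" unfolding bba by (simp only: ba)
    then show ?thesis using cB b by (simp add: s bilinear) (simp add: c_def algebra_simps scaleR_2)
  qed
  moreover have "(s \<cdot> t) \<cdot> (s \<cdot> t) = (s \<cdot> s) \<cdot> (t \<cdot> t)"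
    using s(1) t(1) by (simp add: ac)
  moreover have "(s \<cdot> s) \<cdot> (t \<cdot> t) = s \<cdot> s - \<delta> *\<^sub>R ((s \<cdot> s) \<cdot> c)"
    using s(1) by (simp add: t(2) bilinear)
  ultimately have eq: "x \<cdot> x + (s \<cdot> t) \<cdot> (s \<cdot> t) =
      (1 + \<epsilon> - \<delta>) *\<^sub>R e - (\<delta> * \<epsilon>) *\<^sub>R (2 *\<^sub>R b + \<epsilon> *\<^sub>R (b \<cdot> b))"
    by (simp add: s(2) a_def algebra_simps)
  have "1 \<le> norm (x \<cdot> x + (s \<cdot> t) \<cdot> (s \<cdot> t))"
    using arens[of x "s \<cdot> t"] x s t by simp
  also have "\<dots> \<le> (1 + \<epsilon> - \<delta>) + (\<delta> * \<epsilon>) * d"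
  proof -
    have "norm (2 *\<^sub>R b + \<epsilon> *\<^sub>R (b \<cdot> b)) \<le> 2 * norm b + \<epsilon> * (norm b * norm b)"
      using norm_mul[of b b] \<epsilon> by (intro norm_triangle_le add_mono) auto
    also have "\<dots> \<le> 2 * norm b + 1 * (norm b * norm b)"
      using \<epsilon> by (intro add_mono mult_right_mono) auto
    also have "\<dots> \<le> d" by (simp add: d_def power2_eq_square algebra_simps)
    finally have "norm ((\<delta> * \<epsilon>) *\<^sub>R (2 *\<^sub>R b + \<epsilon> *\<^sub>R (b \<cdot> b))) \<le> (\<delta> * \<epsilon>) * d"
      using \<delta> \<epsilon> by (simp add: mult_left_mono)
    moreover have "norm ((1 + \<epsilon> - \<delta>) *\<^sub>R e) = 1 + \<epsilon> - \<delta>" using \<delta> \<epsilon> by (simp add: norm_unit)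
    ultimately show ?thesis unfolding eq by (smt (verit) norm_triangle_ineq4)
  qed
  also have "\<dots> = 1 + \<epsilon> - \<delta> + \<epsilon> / 2"
    using \<delta>d by (simp add: algebra_simps)
  finally show False using \<delta> by (simp add: \<epsilon>_def)
qed

text \<open>For \<open>|y| = 1\<close> the multiples of \<open>e - y\<^sup>2\<close> form a proper ideal. A character vanishing on it takes
  \<open>y\<close> to \<open>1\<close> or \<open>-1\<close>.\<close>

lemma norm_attained:
  assumes x: "x \<in> B"
  shows "\<exists>\<phi>\<in>characters. \<bar>\<phi> x\<bar> = norm x"
proof (cases "x = 0")
  case True
  have "ideal {0}" by (simp add: ideal_def bilinear)
  moreover have "e \<notin> {0}" using norm_unit by auto
  ultimately show ?thesis using proper_ideal_character characterD(7) True by fastforce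
next
  case False
  define y where "y = (1 / norm x) *\<^sub>R x"
  have y: "y \<in> B" "norm y = 1" using x False by (auto simp: y_def)
  define J where "J = {b \<cdot> (e - y \<cdot> y) | b. b \<in> B}"
  have mem: "b \<cdot> (e - y \<cdot> y) \<in> J" if "b \<in> B" for b using that by (auto simp: J_def)
  have "ideal J"
    unfolding ideal_def
  proof (intro conjI ballI)
    show "J \<subseteq> B" using y by (auto simp: J_def)
    show "0 \<in> J" using mem[of 0] by (simp add: bilinear)
    fix u v assume "u \<in> J"
    then obtain b where b: "u = b \<cdot> (e - y \<cdot> y)" "b \<in> B" by (auto simp: J_def)
    show "v \<cdot> u \<in> J" if "v \<in> B" using mem[of "v \<cdot> b"] that b y by (simp add: assoc)
    assume "v \<in> J"
    then obtain c where c: "v = c \<cdot> (e - y \<cdot> y)" "c \<in> B" by (auto simp: J_def)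
    show "u - v \<in> J" using mem[of "b - c"] b c by (simp add: mul.diff_left)
  qed
  moreover have "e \<notin> J" using unit_minus_square_not_invertible[OF y] by (simp add: J_def) metis
  ultimately obtain \<phi> where \<phi>: "\<phi> \<in> characters" "\<And>u. u \<in> J \<Longrightarrow> \<phi> u = 0"
    using proper_ideal_character by blast
  have "e - y \<cdot> y \<in> J" using mem[of e] y by simp
  then have "\<phi> (e - y \<cdot> y) = 0" by (rule \<phi>(2))
  then have "(\<phi> y)\<^sup>2 = 1" using y by (simp add: characterD[OF \<phi>(1)] power2_eq_square)
  then have "\<bar>\<phi> y\<bar> = 1" by (simp add: power2_eq_1_iff) auto
  moreover have "\<phi> x = norm x * \<phi> y"
    using False characterD(3)[OF \<phi>(1) y(1), of "norm x"] by (simp add: y_def)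
  ultimately have "\<bar>\<phi> x\<bar> = norm x" by (simp add: abs_mult)
  then show ?thesis using \<phi>(1) by blast
qed

text \<open>The Banach-Alaoglu argument: a closed subset of a product of compact intervals.\<close>

lemma compact_characters: "compact characters"
proof -
  have box: "compact (Pi\<^sub>E UNIV (\<lambda>x::'a. {- norm x .. norm x}))"
    using compactin_PiE[of "\<lambda>_. euclideanreal" UNIV "\<lambda>x::'a. {- norm x .. norm x}"]
    by (simp add: euclidean_product_topology)
  have "closed characters"
    unfolding characters_def Ball_def
    by (intro closed_Collect_conj closed_Collect_all closed_Collect_imp open_Collect_const
        closed_Collect_eq continuous_intros continuous_on_product_coordinates)
  moreover have "characters \<subseteq> Pi\<^sub>E UNIV (\<lambda>x::'a. {- norm x .. norm x})"
  proof
    fix \<phi> assume "\<phi> \<in> characters"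
    then have "- norm x \<le> \<phi> x \<and> \<phi> x \<le> norm x" for x
      using character_bound[of \<phi> x] by linarith
    then show "\<phi> \<in> Pi\<^sub>E UNIV (\<lambda>x::'a. {- norm x .. norm x})" by (simp add: PiE_iff)
  qed
  ultimately show ?thesis
    using compact_Int_closed[OF box, of characters] by (simp add: Int_absorb1)
qed

text \<open>By \<open>norm_attained\<close> the elements of \<open>B\<close> carry the supremum norm over the characters, so uniform
  approximations from Stone-Weierstrass form a Cauchy sequence in \<open>B\<close>.\<close>

lemma continuous_function_represented:
  assumes g: "continuous_on characters g"
  shows "\<exists>x\<in>B. \<forall>\<phi>\<in>characters. \<phi> x = g \<phi>"
proof -
  define R where "R = {f. \<exists>x\<in>B. \<forall>\<phi>\<in>characters. f \<phi> = \<phi> x}"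
  interpret function_ring_on R characters
  proof
    show "compact characters" by (rule compact_characters)
    show "continuous_on characters f" if f: "f \<in> R" for f
    proof -
      obtain x where "\<And>\<phi>. \<phi> \<in> characters \<Longrightarrow> f \<phi> = \<phi> x" using f unfolding R_def by blast
      moreover have "continuous_on characters (\<lambda>\<phi>. \<phi> x)"
        by (rule continuous_on_subset[OF continuous_on_product_coordinates subset_UNIV])
      ultimately show ?thesis by (rule continuous_on_cong[OF refl, THEN iffD2])
    qed
    have "c = \<phi> (c *\<^sub>R e)" if "\<phi> \<in> characters" for \<phi> c
      using characterD(3)[OF that unit_mem] characterD(4)[OF that] by simp
    then show "(\<lambda>_. c) \<in> R" for c
      unfolding R_def using subspace_scale[OF subspace unit_mem] by blast
    fix f f' assume "f \<in> R" "f' \<in> R"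
    then obtain x x' where x: "x \<in> B" "x' \<in> B" "\<And>\<phi>. \<phi> \<in> characters \<Longrightarrow> f \<phi> = \<phi> x"
      "\<And>\<phi>. \<phi> \<in> characters \<Longrightarrow> f' \<phi> = \<phi> x'" unfolding R_def by blast
    have "f \<phi> + f' \<phi> = \<phi> (x + x')" "f \<phi> * f' \<phi> = \<phi> (x \<cdot> x')" if \<phi>: "\<phi> \<in> characters" for \<phi>
      using x(3,4)[OF \<phi>] characterD(1,2)[OF \<phi> x(1,2)] by simp_all
    moreover have "x + x' \<in> B" "x \<cdot> x' \<in> B" using x by simp_all
    ultimately show "(\<lambda>\<phi>. f \<phi> + f' \<phi>) \<in> R" "(\<lambda>\<phi>. f \<phi> * f' \<phi>) \<in> R"
      unfolding R_def by blast+
  next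
    fix \<phi> \<psi> assume \<phi>: "\<phi> \<in> characters" "\<psi> \<in> characters" "\<phi> \<noteq> \<psi>"
    then obtain x where "\<phi> x \<noteq> \<psi> x" by blast
    moreover from this \<phi> have "x \<in> B" using characterD(5) by metis
    ultimately show "\<exists>f\<in>R. f \<phi> \<noteq> f \<psi>"
      unfolding R_def by (intro bexI[of _ "\<lambda>\<phi>. \<phi> x"]) auto
  qed
  have "\<exists>x\<in>B. \<forall>\<phi>\<in>characters. \<bar>g \<phi> - \<phi> x\<bar> < 1 / real (Suc n)" for n
    using Stone_Weierstrass_basic[OF g, of "1 / real (Suc n)"] by (force simp: R_def)
  then obtain x where x: "\<And>n. x n \<in> B"
    and gx: "\<And>n \<phi>. \<phi> \<in> characters \<Longrightarrow> \<bar>g \<phi> - \<phi> (x n)\<bar> < 1 / real (Suc n)"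
    by metis
  have dist: "norm (x m - x n) < 1 / real (Suc m) + 1 / real (Suc n)" for m n
  proof -
    obtain \<phi> where \<phi>: "\<phi> \<in> characters" "\<bar>\<phi> (x m - x n)\<bar> = norm (x m - x n)"
      using norm_attained[of "x m - x n"] x by auto
    then have "\<bar>\<phi> (x m) - \<phi> (x n)\<bar> = norm (x m - x n)" using x by (simp add: characterD[OF \<phi>(1)])
    then show ?thesis using gx[OF \<phi>(1), of m] gx[OF \<phi>(1), of n] by linarith
  qed
  have "Cauchy x"
  proof (rule metric_CauchyI)
    fix \<epsilon> :: real assume "\<epsilon> > 0"
    then obtain k where k: "1 / real (Suc k) < \<epsilon> / 2" using nat_approx_posE[of "\<epsilon>/2"] by auto
    have "dist (x m) (x n) < \<epsilon>" if "m \<ge> k" "n \<ge> k" for m n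
    proof -
      have "1 / real (Suc m) \<le> 1 / real (Suc k)" "1 / real (Suc n) \<le> 1 / real (Suc k)"
        using that by (auto simp: divide_simps)
      then show ?thesis using dist[of m n] k by (simp add: dist_norm)
    qed
    then show "\<exists>M. \<forall>m\<ge>M. \<forall>n\<ge>M. dist (x m) (x n) < \<epsilon>" by blast
  qed
  then obtain y where y: "x \<longlonglongrightarrow> y" using Cauchy_convergent_iff convergent_def by blast
  have yB: "y \<in> B" using closed_sequentially[OF closed x y] .
  have "\<phi> y = g \<phi>" if \<phi>: "\<phi> \<in> characters" for \<phi>
  proof (rule LIMSEQ_unique)
    have null: "(\<lambda>n. 1 / real (Suc n)) \<longlonglongrightarrow> 0"
      using LIMSEQ_inverse_real_of_nat by (simp add: inverse_eq_divide)
    have "dist (\<phi> (x n)) (g \<phi>) \<le> dist (1 / real (Suc n)) 0" for n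
      using gx[OF \<phi>, of n] by (simp add: dist_real_def abs_minus_commute)
    then show "(\<lambda>n. \<phi> (x n)) \<longlonglongrightarrow> g \<phi>"
      by (intro metric_tendsto_imp_tendsto[OF null] always_eventually allI)
    have "dist (\<phi> (x n)) (\<phi> y) \<le> dist (x n) y" for n
      using character_bound[OF \<phi>, of "x n - y"] x yB by (simp add: characterD[OF \<phi>] dist_norm)
    then show "(\<lambda>n. \<phi> (x n)) \<longlonglongrightarrow> \<phi> y"
      by (intro metric_tendsto_imp_tendsto[OF y] always_eventually allI)
  qed
  then show ?thesis using yB by blast
qed

end


section \<open>Conjugation on quaternions and octonions\<close>

text \<open>A common interface to both algebras of scalars, free of associativity, so that the quaternionic and
  the octonionic case need only one proof.\<close>

locale conjugation_algebra =
  fixes K :: "'k::euclidean_space scalars"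
  assumes smult_bilinear: "bilinear (smult K)" and sconj_linear: "linear (sconj K)"
    and gen0_left: "smult K (gen K 0) a = a" and gen0_right: "smult K a (gen K 0) = a"
    and sconj_sconj: "sconj K (sconj K a) = a"
    and sconj_smult: "sconj K (smult K a b) = smult K (sconj K b) (sconj K a)"
    and smult_sconj: "smult K a (sconj K a) = (norm a)\<^sup>2 *\<^sub>R gen K 0"
    and sconj_gen0: "sconj K (gen K 0) = gen K 0"
    and sconj_gen: "0 < j \<Longrightarrow> j \<le> last_gen K \<Longrightarrow> sconj K (gen K j) = - gen K j"
    and gen_orthonormal: "i \<le> last_gen K \<Longrightarrow> j \<le> last_gen K \<Longrightarrow>
      gen K i \<bullet> gen K j = (if i = j then 1 else 0)"
    and gen_expansion: "(\<Sum>j\<le>last_gen K. (a \<bullet> gen K j) *\<^sub>R gen K j) = a"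
    and last_gen_pos: "0 < last_gen K"
begin

lemmas smult_simps = bilinear_ladd[OF smult_bilinear] bilinear_radd[OF smult_bilinear]
  bilinear_lmul[OF smult_bilinear] bilinear_rmul[OF smult_bilinear]
  bilinear_lneg[OF smult_bilinear] bilinear_rneg[OF smult_bilinear]
  bilinear_lsub[OF smult_bilinear] bilinear_rsub[OF smult_bilinear]
  bilinear_lzero[OF smult_bilinear] bilinear_rzero[OF smult_bilinear]

lemmas sconj_simps = linear_add[OF sconj_linear] linear_scale[OF sconj_linear] linear_neg[OF sconj_linear]
  linear_diff[OF sconj_linear]

lemma norm_gen0: "norm (gen K 0) = 1"
  using gen_orthonormal[of 0 0] by (simp add: norm_eq_sqrt_inner)

text \<open>Polarisation of \<open>a a\<^sup>~ = |a|\<^sup>2\<close>. In particular \<open>a \<bullet> b\<close> is the real part of \<open>a b\<^sup>~\<close>, which later lets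
  the coordinates of an element be read off by multiplication.\<close>

lemma smult_sconj_polarised:
  "smult K a (sconj K b) + smult K b (sconj K a) = (2 * (a \<bullet> b)) *\<^sub>R gen K 0"
proof -
  have "(norm (a + b))\<^sup>2 = (norm a)\<^sup>2 + 2 * (a \<bullet> b) + (norm b)\<^sup>2"
    by (simp add: power2_norm_eq_inner inner_commute algebra_simps)
  then show ?thesis
    using smult_sconj[of "a + b"] smult_sconj[of a] smult_sconj[of b]
    by (simp add: smult_simps sconj_simps scaleR_add_left algebra_simps)
qed

lemma add_sconj: "a + sconj K a = (2 * (a \<bullet> gen K 0)) *\<^sub>R gen K 0"
  using smult_sconj_polarised[of a "gen K 0"] by (simp add: sconj_gen0 gen0_left gen0_right)

lemma inner_smult_sconj: "smult K a (sconj K b) \<bullet> gen K 0 = a \<bullet> b"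
proof -
  have "(2 * (smult K a (sconj K b) \<bullet> gen K 0)) *\<^sub>R gen K 0 = (2 * (a \<bullet> b)) *\<^sub>R gen K 0"
    by (simp add: sconj_smult sconj_sconj smult_sconj_polarised flip: add_sconj)
  then show ?thesis using norm_gen0 by auto
qed

text \<open>\<open>a\<^sup>~\<close> is a real number minus \<open>a\<close>, hence commutes with \<open>a\<close>.\<close>

lemma sconj_smult_self: "smult K (sconj K a) a = (norm a)\<^sup>2 *\<^sub>R gen K 0"
proof -
  have "sconj K a = (2 * (a \<bullet> gen K 0)) *\<^sub>R gen K 0 - a"
    using add_sconj[of a] by (simp add: algebra_simps)
  then have "smult K (sconj K a) a = smult K a (sconj K a)"
    by (simp add: smult_simps gen0_left gen0_right)
  then show ?thesis by (simp add: smult_sconj)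
qed

end

lemma conjugation_algebra_Quat: "conjugation_algebra Quat"
proof (rule conjugation_algebra.intro)
  show "bilinear (smult Quat)"
    by (auto simp: bilinear_def Quat_def qmult_def linear_iff scaleR_prod_def algebra_simps scaleR_conv_of_real split: prod.splits)
  show "linear (sconj Quat)"
    by (auto simp: Quat_def qconj_def linear_iff split: prod.splits)
  show "smult Quat a (sconj Quat a) = (norm a)\<^sup>2 *\<^sub>R gen Quat 0" for a
    by (simp add: Quat_def quaternion_norm)
  fix a b :: quaternion
  show "smult Quat (gen Quat 0) a = a" "smult Quat a (gen Quat 0) = a"
    "sconj Quat (sconj Quat a) = a" "sconj Quat (gen Quat 0) = gen Quat 0"
    "sconj Quat (smult Quat a b) = smult Quat (sconj Quat b) (sconj Quat a)"
    by (cases a; cases b; simp add: Quat_def qmult_def qconj_def qgen_def algebra_simps)+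
  show "(\<Sum>j\<le>last_gen Quat. (a \<bullet> gen Quat j) *\<^sub>R gen Quat j) = a"
    by (cases a) (simp add: Quat_def qgen_def numeral_3_eq_3 inner_complex_def complex_eq_iff)
  show "0 < last_gen Quat" by (simp add: Quat_def)
  have index: "j \<le> last_gen Quat \<longleftrightarrow> j \<in> {0, 1, 2, 3}" for j
    by (auto simp: Quat_def)
  show "sconj Quat (gen Quat j) = - gen Quat j" if "0 < j" "j \<le> last_gen Quat" for j
    using that by (auto simp: index) (auto simp: Quat_def qgen_def qconj_def)
  show "gen Quat i \<bullet> gen Quat j = (if i = j then 1 else 0)"
    if "i \<le> last_gen Quat" "j \<le> last_gen Quat" for i j
    using that by (auto simp: index) (auto simp: Quat_def qgen_def inner_complex_def)
qed

lemma conjugation_algebra_Oct: "conjugation_algebra Oct"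
proof -
  interpret q: conjugation_algebra Quat by (rule conjugation_algebra_Quat)
  have q: "smult Quat = qmult" "sconj Quat = qconj" "gen Quat = qgen" "last_gen Quat = 3"
    by (simp_all add: Quat_def)
  note simps = q.smult_simps[unfolded q] q.sconj_simps[unfolded q] q.sconj_sconj[unfolded q]
    q.sconj_smult[unfolded q] q.gen0_left[unfolded q] q.gen0_right[unfolded q] q.sconj_gen0[unfolded q]
  have conj0: "qconj 0 = 0" using simps(12)[of 0] by simp
  show ?thesis
  proof (rule conjugation_algebra.intro)
    show "bilinear (smult Oct)"
      by (auto simp: bilinear_def Oct_def omult_def linear_iff simps algebra_simps split: prod.splits)
    show "linear (sconj Oct)"
      by (auto simp: Oct_def oconj_def linear_iff simps split: prod.splits)
    show "smult Oct a (sconj Oct a) = (norm a)\<^sup>2 *\<^sub>R gen Oct 0" for a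
      by (simp add: Oct_def octonion_norm)
    fix a b :: octonion
    obtain u v u' v' where a: "a = (u, v)" and b: "b = (u', v')" by (metis surj_pair)
    show "smult Oct (gen Oct 0) a = a" "smult Oct a (gen Oct 0) = a"
      "sconj Oct (sconj Oct a) = a" "sconj Oct (gen Oct 0) = gen Oct 0"
      "sconj Oct (smult Oct a b) = smult Oct (sconj Oct b) (sconj Oct a)"
      unfolding a b by (simp_all add: Oct_def omult_def oconj_def ogen_def simps conj0 algebra_simps)
    \<comment> \<open>The eight octonion units are two copies of the four quaternion units.\<close>
    have sum: "(\<Sum>j\<le>7::nat. f j) = (\<Sum>j\<le>3. f j) + (\<Sum>j\<le>3. f (j + 4))" for f :: "nat \<Rightarrow> octonion"
      by (simp add: eval_nat_numeral)
    have "(\<Sum>j\<le>7. (a \<bullet> ogen j) *\<^sub>R ogen j) = ((\<Sum>j\<le>3. (u \<bullet> qgen j) *\<^sub>R qgen j), (\<Sum>j\<le>3. (v \<bullet> qgen j) *\<^sub>R qgen j))"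
      unfolding sum by (simp add: ogen_def a sum_prod)
    then show "(\<Sum>j\<le>last_gen Oct. (a \<bullet> gen Oct j) *\<^sub>R gen Oct j) = a"
      using q.gen_expansion[unfolded q] by (simp add: Oct_def a)
    show "0 < last_gen Oct" by (simp add: Oct_def)
    show "sconj Oct (gen Oct j) = - gen Oct j" if "0 < j" "j \<le> last_gen Oct" for j
      using that q.sconj_gen[unfolded q, of j] by (simp add: Oct_def ogen_def oconj_def conj0)
    show "gen Oct i \<bullet> gen Oct j = (if i = j then 1 else 0)"
      if "i \<le> last_gen Oct" "j \<le> last_gen Oct" for i j
      using that q.gen_orthonormal[unfolded q, of i j] q.gen_orthonormal[unfolded q, of "i - 4" "j - 4"]
      by (auto simp: Oct_def ogen_def)
  qed
qed


section \<open>Reduction to the hermitian elements\<close>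

locale quasicommutative_cstar_algebra = scalar_cstar_algebra K A + conjugation_algebra K
  for K :: "'k::euclidean_space scalars" and A :: "('k, 'a::banach) star_algebra" +
  assumes quasicommutative: "quasicommutative K A"
begin

text \<open>The involution is written with a dagger, since the superscript star denotes reflexive transitive
  closure.\<close>

abbreviation mul (infixl "\<cdot>" 70) where "x \<cdot> y \<equiv> amult A x y"
abbreviation adj ("_\<^sup>\<dagger>" [1000] 999) where "x\<^sup>\<dagger> \<equiv> star A x"
abbreviation unt ("e") where "e \<equiv> aunit A"
abbreviation smul (infixl "\<odot>" 75) where "x \<odot> a \<equiv> rscale A x a"
abbreviation generator ("\<ii>") where "\<ii> \<equiv> gen K"
abbreviation m where "m \<equiv> last_gen K"

definition hermitian :: "'a set" where "hermitian = {x. x\<^sup>\<dagger> = x}"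

sublocale mul: bounded_bilinear "amult A"
  using norm_amult by unfold_locales
    (auto simp: amult_add_left amult_add_right amult_scaleR_left amult_scaleR_right intro!: exI[of _ 1])

lemmas bilinear = mul.add_left mul.add_right mul.diff_left mul.diff_right mul.scaleR_left
  mul.scaleR_right mul.minus_left mul.minus_right mul.zero_left mul.zero_right

lemma rscale_gen0: "x \<odot> \<ii> 0 = x"
  using rsc_real[of x 1] by simp

lemma star_scaleR: "(r *\<^sub>R x)\<^sup>\<dagger> = r *\<^sub>R x\<^sup>\<dagger>"
proof -
  have "(r *\<^sub>R x)\<^sup>\<dagger> = (lscale A (r *\<^sub>R \<ii> 0) x)\<^sup>\<dagger>" by (simp add: lsc_real)
  also have "\<dots> = r *\<^sub>R x\<^sup>\<dagger>" by (simp add: star_lscale sconj_simps sconj_gen0 rsc_real)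
  finally show ?thesis .
qed

lemma norm_star: "norm (x\<^sup>\<dagger>) = norm x"
proof -
  have le: "norm x \<le> norm (x\<^sup>\<dagger>)" for x
  proof (cases "x = 0")
    case False
    have "norm x * norm x \<le> norm (x\<^sup>\<dagger>) * norm x"
      using cstar_identity[of x] norm_amult[of "x\<^sup>\<dagger>" x] by (simp add: power2_eq_square)
    then show ?thesis using False by simp
  qed simp
  show ?thesis using le[of x] le[of "x\<^sup>\<dagger>"] by (simp add: star_star)
qed

lemma bounded_linear_star: "bounded_linear (star A)"
  by (rule bounded_linear_intro[where K=1]) (auto simp: star_add star_scaleR norm_star)

lemmas star_simps = star_add star_scaleR star_star bounded_linear.linear[OF bounded_linear_star, THEN linear_diff]
  bounded_linear.linear[OF bounded_linear_star, THEN linear_0]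

lemma subspace_hermitian: "subspace hermitian"
  by (auto simp: subspace_def hermitian_def star_simps)

lemma closed_hermitian: "closed hermitian"
  unfolding hermitian_def
  by (intro closed_Collect_eq continuous_on_id bounded_linear.continuous_on[OF bounded_linear_star])

text \<open>Every \<open>x \<in> S\<^sub>j\<close> is hermitian because \<open>(x i\<^sub>0)\<^sup>* = x i\<^sub>0\<close>. Conversely, for \<open>x = \<Sum> x\<^sub>j i\<^sub>j\<close> the sum \<open>x + x\<^sup>*\<close>
  retains only the term \<open>2 x\<^sub>0\<close>, so a hermitian \<open>x\<close> equals \<open>x\<^sub>0 \<in> S\<^sub>0\<close>. Thus \<open>S\<^sub>0\<close> consists exactly of the
  hermitian elements and contains every \<open>S\<^sub>j\<close>, and the decomposition can be restated with the single
  space \<open>hermitian\<close> for all coefficients.\<close>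

lemma hermitian_structure:
  "e \<in> hermitian"
  "x \<in> hermitian \<Longrightarrow> y \<in> hermitian \<Longrightarrow> x \<cdot> y \<in> hermitian"
  "x \<in> hermitian \<Longrightarrow> y \<in> hermitian \<Longrightarrow> x \<cdot> y = y \<cdot> x"
  "x \<in> hermitian \<Longrightarrow> y \<in> hermitian \<Longrightarrow> z \<in> hermitian \<Longrightarrow> x \<cdot> y \<cdot> z = x \<cdot> (y \<cdot> z)"
  "x \<in> hermitian \<Longrightarrow> y \<in> hermitian \<Longrightarrow> (x \<odot> a) \<cdot> (y \<odot> b) = (x \<cdot> y) \<odot> smult K a b"
  "x \<in> hermitian \<Longrightarrow> (x \<odot> a)\<^sup>\<dagger> = x \<odot> sconj K a"
  "x \<in> hermitian \<Longrightarrow> lscale A a x = x \<odot> a"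
  "\<exists>c. (\<forall>j\<le>m. c j \<in> hermitian) \<and> v = (\<Sum>j\<le>m. c j \<odot> \<ii> j)"
proof -
  obtain S where S: "\<forall>j\<le>m. real_subalgebra A (S j)"
    "\<forall>x\<in>S 0. \<forall>y\<in>S 0. x \<cdot> y = y \<cdot> x"
    "\<forall>x\<in>S 0. \<forall>y\<in>S 0. \<forall>z\<in>S 0. x \<cdot> y \<cdot> z = x \<cdot> (y \<cdot> z)"
    "component_decomposition K (lscale A) (rscale A) S"
    "\<forall>j\<le>m. \<forall>k\<le>m. \<forall>x\<in>S j. \<forall>y\<in>S k. \<forall>a b.
      (x \<odot> a) \<cdot> (y \<odot> b) = (x \<cdot> y) \<odot> smult K a b"
    "\<forall>j\<le>m. \<forall>x\<in>S j. \<forall>a. (x \<odot> a)\<^sup>\<dagger> = x \<odot> sconj K a"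
    using quasicommutative unfolding quasicommutative_def by (elim exE conjE) (rule that)
  note dec = S(4)
  have star: "(x \<odot> a)\<^sup>\<dagger> = x \<odot> sconj K a" if "j \<le> m" "x \<in> S j" for j x a
    using S(6) that by blast
  have decompose: "\<exists>c. (\<forall>j\<le>m. c j \<in> S j) \<and> v = (\<Sum>j\<le>m. c j \<odot> \<ii> j)" for v
  proof -
    have "\<exists>c. c \<in> (\<Pi>\<^sub>E j\<in>{..m}. S j) \<and> v = (\<Sum>j\<le>m. c j \<odot> \<ii> j)"
      using dec unfolding component_decomposition_def by blast
    then show ?thesis by (auto simp: PiE_iff)
  qed
  have central: "lscale A a x = x \<odot> a" if "x \<in> S 0" for a x
    using dec that unfolding component_decomposition_def by blast
  have S_sub: "S j \<subseteq> hermitian" if "j \<le> m" for j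
    using star[OF that, of _ "\<ii> 0"] by (auto simp: hermitian_def sconj_gen0 rscale_gen0)
  have "x \<in> S 0" if x: "x \<in> hermitian" for x
  proof -
    obtain c where c: "\<And>j. j \<le> m \<Longrightarrow> c j \<in> S j" "x = (\<Sum>j\<le>m. c j \<odot> \<ii> j)"
      using decompose by blast
    have "x\<^sup>\<dagger> = (\<Sum>j\<le>m. c j \<odot> sconj K (\<ii> j))"
      unfolding c(2) linear_sum[OF bounded_linear.linear[OF bounded_linear_star]]
      by (intro sum.cong) (auto intro: star c)
    then have "x + x\<^sup>\<dagger> = (\<Sum>j\<le>m. c j \<odot> (\<ii> j + sconj K (\<ii> j)))"
      by (subst (1) c(2)) (simp add: rsc_add_scalar sum.distrib)
    also have "\<dots> = (\<Sum>j\<le>m. if j = 0 then 2 *\<^sub>R c 0 else 0)"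
    proof (intro sum.cong refl)
      fix j assume "j \<in> {..m}"
      then show "c j \<odot> (\<ii> j + sconj K (\<ii> j)) = (if j = 0 then 2 *\<^sub>R c 0 else 0)"
        using rsc_real[of "c j" 0] rsc_real[of "c 0" 2]
        by (auto simp: sconj_gen sconj_gen0 scaleR_2)
    qed
    finally have "2 *\<^sub>R x = 2 *\<^sub>R c 0" using x by (simp add: hermitian_def scaleR_2)
    then show ?thesis using c(1)[of 0] by simp
  qed
  then have S0: "S 0 = hermitian" using S_sub[of 0] by blast
  show "e \<in> hermitian" "x \<in> hermitian \<Longrightarrow> y \<in> hermitian \<Longrightarrow> x \<cdot> y \<in> hermitian"
    using S(1) by (auto simp: real_subalgebra_def S0)
  show "x \<in> hermitian \<Longrightarrow> y \<in> hermitian \<Longrightarrow> x \<cdot> y = y \<cdot> x"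
    "x \<in> hermitian \<Longrightarrow> y \<in> hermitian \<Longrightarrow> z \<in> hermitian \<Longrightarrow> x \<cdot> y \<cdot> z = x \<cdot> (y \<cdot> z)"
    "x \<in> hermitian \<Longrightarrow> lscale A a x = x \<odot> a"
    using S(2,3) central unfolding S0 by blast+
  show "x \<in> hermitian \<Longrightarrow> y \<in> hermitian \<Longrightarrow> (x \<odot> a) \<cdot> (y \<odot> b) = (x \<cdot> y) \<odot> smult K a b"
    "x \<in> hermitian \<Longrightarrow> (x \<odot> a)\<^sup>\<dagger> = x \<odot> sconj K a"
    using S(5) star[of 0 x a] S0 by blast+
  show "\<exists>c. (\<forall>j\<le>m. c j \<in> hermitian) \<and> v = (\<Sum>j\<le>m. c j \<odot> \<ii> j)"
    using decompose[of v] S_sub by blast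
qed

lemma rscale_scaleR_right: "x \<in> hermitian \<Longrightarrow> x \<odot> (r *\<^sub>R a) = r *\<^sub>R (x \<odot> a)"
  using hermitian_structure(5)[OF _ hermitian_structure(1), of x "r *\<^sub>R \<ii> 0" a]
    hermitian_structure(5)[OF _ hermitian_structure(1), of x "\<ii> 0" a]
  by (simp add: rsc_real rscale_gen0 smult_simps gen0_left unit_right bilinear)

definition real_part :: "'a \<Rightarrow> 'a" where "real_part x = (1/2) *\<^sub>R (x + x\<^sup>\<dagger>)"

lemma real_part_hermitian: "real_part x \<in> hermitian"
  by (simp add: real_part_def hermitian_def star_simps add.commute)

lemma linear_real_part: "linear real_part"
  by (auto simp: linear_iff real_part_def star_simps algebra_simps)

lemma norm_real_part: "norm (real_part x) \<le> norm x"
  using norm_triangle_ineq[of x "x\<^sup>\<dagger>"] by (simp add: real_part_def norm_star)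

lemma real_part_rscale: "x \<in> hermitian \<Longrightarrow> real_part (x \<odot> a) = (a \<bullet> \<ii> 0) *\<^sub>R x"
  by (simp add: real_part_def hermitian_structure(6) add_sconj rsc_real flip: rsc_add_scalar)

text \<open>Arens' condition comes from the \<open>C\<^sup>*\<close>-identity for \<open>z = x + y i\<^sub>1\<close>, where \<open>z\<^sup>* z = x\<^sup>2 + y\<^sup>2\<close> and \<open>x\<close> is the
  real part of \<open>z\<close>.\<close>

sublocale hermitian: arens_algebra hermitian "amult A" "aunit A"
proof (rule arens_algebra.intro)
  show "(norm x)\<^sup>2 \<le> norm (x \<cdot> x + y \<cdot> y)" if x: "x \<in> hermitian" and y: "y \<in> hermitian" for x y
  proof -
    note H = hermitian_structure
    have conj1: "sconj K (\<ii> 1) = - \<ii> 1" using sconj_gen[of 1] last_gen_pos by simp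
    have sq1: "smult K (- \<ii> 1) (\<ii> 1) = \<ii> 0"
      using sconj_smult_self[of "\<ii> 1"] gen_orthonormal[of 1 1] last_gen_pos
      by (simp add: conj1 power2_norm_eq_inner del: One_nat_def)
    have neg: "y \<odot> (- \<ii> 1) = - (y \<odot> \<ii> 1)"
      using rscale_scaleR_right[OF y, of "-1" "\<ii> 1"] by simp
    define w where "w = y \<odot> \<ii> 1"
    define z where "z = x + w"
    have z_star: "z\<^sup>\<dagger> = x - w"
      using x by (simp add: z_def w_def star_add H(6)[OF y] conj1 neg hermitian_def del: One_nat_def)
    have xw: "x \<cdot> w = w \<cdot> x"
      using H(5)[OF x y, of "\<ii> 0" "\<ii> 1"] H(5)[OF y x, of "\<ii> 1" "\<ii> 0"] H(3)[OF x y]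
      by (simp add: w_def rscale_gen0 gen0_left gen0_right)
    have ww: "w \<cdot> w = - (y \<cdot> y)"
      using H(5)[OF y y, of "- \<ii> 1" "\<ii> 1"] unfolding w_def neg sq1
      by (simp add: bilinear rscale_gen0 minus_equation_iff)
    have "z\<^sup>\<dagger> \<cdot> z = x \<cdot> x + y \<cdot> y"
      unfolding z_star unfolding z_def by (simp add: bilinear xw ww)
    then have z: "norm (x \<cdot> x + y \<cdot> y) = (norm z)\<^sup>2"
      using cstar_identity[of z] by simp
    have "real_part z = x"
      using real_part_rscale[OF y, of "\<ii> 1"] real_part_rscale[OF x, of "\<ii> 0"]
        gen_orthonormal[of 1 0] gen_orthonormal[of 0 0] last_gen_pos
      by (simp add: z_def w_def linear_add[OF linear_real_part] rscale_gen0)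
    then have "norm x \<le> norm z" using norm_real_part[of z] by simp
    then show ?thesis by (simp add: z power_mono)
  qed
qed (auto simp: subspace_hermitian closed_hermitian hermitian_structure(1,2) unit_left norm_unit
    norm_amult bilinear intro: hermitian_structure(3,4))

text \<open>The coefficient of \<open>i\<^sub>j\<close>, by the analogue of \<open>Re (a i\<^sub>j\<^sup>~) = a \<bullet> i\<^sub>j\<close> in the scalars. As an explicit
  formula it is visibly linear, and it shows that the coefficients are unique.\<close>

definition coordinate :: "nat \<Rightarrow> 'a \<Rightarrow> 'a" where
  "coordinate j x = real_part (x \<cdot> (e \<odot> sconj K (\<ii> j)))"

lemma coordinate_hermitian: "coordinate j x \<in> hermitian"
  by (simp add: coordinate_def real_part_hermitian)

lemma linear_coordinate: "linear (coordinate j)"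
  by (auto simp: linear_iff coordinate_def bilinear linear_add[OF linear_real_part]
      linear_scale[OF linear_real_part])

lemma coordinate_rscale: "x \<in> hermitian \<Longrightarrow> coordinate j (x \<odot> a) = (a \<bullet> \<ii> j) *\<^sub>R x"
  by (simp add: coordinate_def hermitian_structure(5) real_part_rscale inner_smult_sconj)

lemma coordinate_expansion: "(\<Sum>j\<le>m. coordinate j x \<odot> \<ii> j) = x"
proof -
  obtain c where c: "\<And>j. j \<le> m \<Longrightarrow> c j \<in> hermitian" "x = (\<Sum>j\<le>m. c j \<odot> \<ii> j)"
    using hermitian_structure(8) by blast
  have "coordinate j x = c j" if j: "j \<le> m" for j
  proof -
    have "coordinate j x = (\<Sum>i\<le>m. coordinate j (c i \<odot> \<ii> i))"
      unfolding c(2) by (rule linear_sum[OF linear_coordinate])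
    also have "\<dots> = (\<Sum>i\<le>m. if i = j then c j else 0)"
      using c(1) j by (intro sum.cong) (auto simp: coordinate_rscale gen_orthonormal)
    finally show ?thesis using j by simp
  qed
  then show ?thesis by (simp add: c(2))
qed

lemma star_amult_hermitian: "x\<^sup>\<dagger> \<cdot> x \<in> hermitian"
  by (simp add: hermitian_def star_amult star_star)

text \<open>The homomorphism into the scalars that extends the character \<open>\<phi>\<close> of the hermitian elements; as a
  function of \<open>\<phi>\<close> it is the Gelfand transform of \<open>x\<close>.\<close>

definition gelfand :: "('a \<Rightarrow> real) \<Rightarrow> 'a \<Rightarrow> 'k" where
  "gelfand \<phi> x = (\<Sum>j\<le>m. \<phi> (coordinate j x) *\<^sub>R \<ii> j)"

context
  fixes \<phi> assumes \<phi>: "\<phi> \<in> hermitian.characters"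
begin

lemma linear_gelfand: "linear (gelfand \<phi>)"
  by (auto simp: linear_iff gelfand_def linear_add[OF linear_coordinate] linear_scale[OF linear_coordinate]
      hermitian.characterD[OF \<phi>] coordinate_hermitian scaleR_add_left sum.distrib scaleR_sum_right)

lemma gelfand_rscale: "x \<in> hermitian \<Longrightarrow> gelfand \<phi> (x \<odot> a) = \<phi> x *\<^sub>R a"
  using gen_expansion[of a]
  by (simp add: gelfand_def coordinate_rscale hermitian.characterD[OF \<phi>] mult.commute
      flip: scaleR_scaleR scaleR_sum_right)

lemma gelfand_hermitian: "x \<in> hermitian \<Longrightarrow> gelfand \<phi> x = \<phi> x *\<^sub>R \<ii> 0"
  using gelfand_rscale[of x "\<ii> 0"] by (simp add: rscale_gen0)

lemma gelfand_unit: "gelfand \<phi> e = \<ii> 0"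
  by (simp add: gelfand_hermitian hermitian_structure(1) hermitian.characterD[OF \<phi>])

lemma gelfand_amult: "gelfand \<phi> (x \<cdot> y) = smult K (gelfand \<phi> x) (gelfand \<phi> y)"
proof -
  let ?x = "\<lambda>i. coordinate i x" and ?y = "\<lambda>j. coordinate j y"
  have "x \<cdot> y = (\<Sum>i\<le>m. ?x i \<odot> \<ii> i) \<cdot> (\<Sum>j\<le>m. ?y j \<odot> \<ii> j)"
    by (simp add: coordinate_expansion)
  also have "\<dots> = (\<Sum>i\<le>m. \<Sum>j\<le>m. (?x i \<cdot> ?y j) \<odot> smult K (\<ii> i) (\<ii> j))"
    by (simp add: mul.sum_left mul.sum_right hermitian_structure(5) coordinate_hermitian)
      (rule sum.swap)
  finally have "gelfand \<phi> (x \<cdot> y) =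
      (\<Sum>i\<le>m. \<Sum>j\<le>m. (\<phi> (?x i) * \<phi> (?y j)) *\<^sub>R smult K (\<ii> i) (\<ii> j))"
    by (simp add: linear_sum[OF linear_gelfand] gelfand_rscale hermitian_structure(2)
        coordinate_hermitian hermitian.characterD(2)[OF \<phi>])
  also have "\<dots> = smult K (gelfand \<phi> x) (gelfand \<phi> y)"
    unfolding gelfand_def bilinear_sum[OF smult_bilinear]
    by (simp add: smult_simps sum.cartesian_product split_def mult.commute)
  finally show ?thesis .
qed

lemma gelfand_star: "gelfand \<phi> (x\<^sup>\<dagger>) = sconj K (gelfand \<phi> x)"
proof -
  have "x\<^sup>\<dagger> = (\<Sum>j\<le>m. (coordinate j x \<odot> \<ii> j)\<^sup>\<dagger>)"
    by (subst (1) coordinate_expansion[symmetric])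
      (rule linear_sum[OF bounded_linear.linear[OF bounded_linear_star]])
  also have "\<dots> = (\<Sum>j\<le>m. coordinate j x \<odot> sconj K (\<ii> j))"
    by (simp add: hermitian_structure(6) coordinate_hermitian)
  finally show ?thesis
    by (simp add: linear_sum[OF linear_gelfand] gelfand_rscale coordinate_hermitian)
      (simp add: gelfand_def linear_sum[OF sconj_linear] sconj_simps)
qed

lemma gelfand_rscale_general: "gelfand \<phi> (x \<odot> a) = smult K (gelfand \<phi> x) a"
  and gelfand_lscale: "gelfand \<phi> (lscale A a x) = smult K a (gelfand \<phi> x)"
proof -
  have "gelfand \<phi> (lscale A a e) = a"
    using gelfand_rscale[of e a]
    by (simp add: hermitian_structure(1,7) hermitian.characterD[OF \<phi>])
  then show "gelfand \<phi> (x \<odot> a) = smult K (gelfand \<phi> x) a"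
    "gelfand \<phi> (lscale A a x) = smult K a (gelfand \<phi> x)"
    by (subst rscale_eq lscale_eq, simp add: gelfand_amult)+
qed

text \<open>The values of the transform are controlled by the real character on \<open>x\<^sup>* x\<close>. This reduces norms,
  and membership in ideals, to the hermitian elements.\<close>

lemma norm_gelfand_square: "(norm (gelfand \<phi> x))\<^sup>2 = \<phi> (x\<^sup>\<dagger> \<cdot> x)"
proof -
  have "(norm (gelfand \<phi> x))\<^sup>2 *\<^sub>R \<ii> 0 = gelfand \<phi> (x\<^sup>\<dagger> \<cdot> x)"
    by (simp add: gelfand_amult gelfand_star sconj_smult_self)
  also have "\<dots> = \<phi> (x\<^sup>\<dagger> \<cdot> x) *\<^sub>R \<ii> 0"
    by (rule gelfand_hermitian) (rule star_amult_hermitian)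
  finally show ?thesis using norm_gen0 by auto
qed

lemma norm_gelfand_le: "norm (gelfand \<phi> x) \<le> norm x"
proof -
  have "(norm (gelfand \<phi> x))\<^sup>2 \<le> (norm x)\<^sup>2"
    using hermitian.character_bound[OF \<phi>, of "x\<^sup>\<dagger> \<cdot> x"] by (simp add: norm_gelfand_square cstar_identity)
  then show ?thesis by (rule power2_le_imp_le) simp
qed

end

lemma norm_gelfand_attained: "\<exists>\<phi>\<in>hermitian.characters. norm (gelfand \<phi> x) = norm x"
proof -
  obtain \<phi> where \<phi>: "\<phi> \<in> hermitian.characters" "\<bar>\<phi> (x\<^sup>\<dagger> \<cdot> x)\<bar> = (norm x)\<^sup>2"
    using hermitian.norm_attained[OF star_amult_hermitian] by (auto simp: cstar_identity)
  then have "(norm (gelfand \<phi> x))\<^sup>2 = (norm x)\<^sup>2"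
    using norm_gelfand_square[OF \<phi>(1), of x] by (metis abs_of_nonneg zero_le_power2)
  then show ?thesis using \<phi>(1) by (intro bexI[of _ \<phi>]) (simp_all add: power2_eq_iff_nonneg)
qed

definition gelfand_kernel :: "('a \<Rightarrow> real) \<Rightarrow> 'a set" where "gelfand_kernel \<phi> = {x. gelfand \<phi> x = 0}"

lemma two_sided_ideal_scaleR:
  assumes "two_sided_ideal A M" "x \<in> M"
  shows "r *\<^sub>R x \<in> M"
proof -
  have "x \<cdot> (r *\<^sub>R e) \<in> M" using assms by (simp add: two_sided_ideal_def)
  then show ?thesis by (simp add: bilinear unit_right)
qed

lemma two_sided_ideal_unit:
  assumes "two_sided_ideal A M" "e \<in> M"
  shows "M = UNIV"
  using assms unfolding two_sided_ideal_def by (metis UNIV_eq_I unit_left)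

text \<open>If an ideal contains the kernel and an element \<open>x\<close> outside of it, it contains \<open>y = x\<^sup>* x\<close>, which is
  congruent modulo the kernel to the nonzero real number \<open>\<phi>(y)\<close>; so it contains the unit.\<close>

lemma kernel_maximal:
  assumes \<phi>: "\<phi> \<in> hermitian.characters"
  shows "gelfand_kernel \<phi> \<in> maximal_ideals A"
  unfolding maximal_ideals_def
proof (intro CollectI conjI allI impI)
  show "two_sided_ideal A (gelfand_kernel \<phi>)"
    by (auto simp: two_sided_ideal_def gelfand_kernel_def linear_0[OF linear_gelfand[OF \<phi>]]
        linear_diff[OF linear_gelfand[OF \<phi>]] gelfand_amult[OF \<phi>] smult_simps)
  have "e \<notin> gelfand_kernel \<phi>" using norm_gen0 by (auto simp: gelfand_kernel_def gelfand_unit[OF \<phi>])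
  then show "gelfand_kernel \<phi> \<noteq> UNIV" by blast
  fix N assume N: "two_sided_ideal A N \<and> gelfand_kernel \<phi> \<subseteq> N"
  show "N = gelfand_kernel \<phi> \<or> N = UNIV"
  proof (rule disjCI)
    assume "N \<noteq> UNIV"
    have "gelfand \<phi> x = 0" if x: "x \<in> N" for x
    proof (rule ccontr)
      assume nz: "gelfand \<phi> x \<noteq> 0"
      define y where "y = x\<^sup>\<dagger> \<cdot> x"
      have yN: "y \<in> N" using x N by (simp add: y_def two_sided_ideal_def)
      have "\<phi> y = (norm (gelfand \<phi> x))\<^sup>2" by (simp add: norm_gelfand_square[OF \<phi>] y_def)
      then have "\<phi> y \<noteq> 0" using nz by simp
      have "gelfand \<phi> (y - \<phi> y *\<^sub>R e) = 0"
        by (simp add: linear_diff[OF linear_gelfand[OF \<phi>]] linear_scale[OF linear_gelfand[OF \<phi>]]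
            gelfand_unit[OF \<phi>] y_def star_amult_hermitian gelfand_hermitian[OF \<phi>])
      then have "y - \<phi> y *\<^sub>R e \<in> N" using N by (auto simp: gelfand_kernel_def)
      then have "y - (y - \<phi> y *\<^sub>R e) \<in> N" using N yN unfolding two_sided_ideal_def by blast
      then have "\<phi> y *\<^sub>R e \<in> N" by simp
      then have "(1 / \<phi> y) *\<^sub>R (\<phi> y *\<^sub>R e) \<in> N" using N two_sided_ideal_scaleR by blast
      then have "e \<in> N" using \<open>\<phi> y \<noteq> 0\<close> by simp
      then show False using two_sided_ideal_unit N \<open>N \<noteq> UNIV\<close> by blast
    qed
    then show "N = gelfand_kernel \<phi>" using N by (auto simp: gelfand_kernel_def)
  qed
qed

text \<open>The hermitian elements of a maximal ideal \<open>M\<close> form a proper ideal, annihilated by some character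
  \<open>\<phi>\<close>. For \<open>x \<in> M\<close> also \<open>x\<^sup>* x \<in> M\<close>, hence \<open>|x(\<phi>)|\<^sup>2 = \<phi>(x\<^sup>* x) = 0\<close>, and \<open>M\<close> lies in the kernel.\<close>

lemma maximal_ideal_is_kernel:
  assumes M: "M \<in> maximal_ideals A"
  shows "\<exists>\<phi>\<in>hermitian.characters. M = gelfand_kernel \<phi>"
proof -
  have I: "two_sided_ideal A M" and "M \<noteq> UNIV"
    and max: "\<And>N. two_sided_ideal A N \<Longrightarrow> M \<subseteq> N \<Longrightarrow> N = M \<or> N = UNIV"
    using M by (auto simp: maximal_ideals_def)
  have "hermitian.ideal (M \<inter> hermitian)"
    using I by (auto simp: hermitian.ideal_def two_sided_ideal_def)
  moreover have "e \<notin> M \<inter> hermitian" using two_sided_ideal_unit[OF I] \<open>M \<noteq> UNIV\<close> by blast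
  ultimately obtain \<phi> where \<phi>: "\<phi> \<in> hermitian.characters" "\<And>x. x \<in> M \<inter> hermitian \<Longrightarrow> \<phi> x = 0"
    using hermitian.proper_ideal_character by blast
  have "M \<subseteq> gelfand_kernel \<phi>"
  proof
    fix x assume "x \<in> M"
    then have "x\<^sup>\<dagger> \<cdot> x \<in> M \<inter> hermitian" using I by (simp add: two_sided_ideal_def star_amult_hermitian)
    then have "(norm (gelfand \<phi> x))\<^sup>2 = 0" by (simp add: norm_gelfand_square[OF \<phi>(1)] \<phi>(2))
    then show "x \<in> gelfand_kernel \<phi>" by (simp add: gelfand_kernel_def)
  qed
  then have "gelfand_kernel \<phi> = M"
    using max[of "gelfand_kernel \<phi>"] kernel_maximal[OF \<phi>(1)] by (auto simp: maximal_ideals_def)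
  then show ?thesis using \<phi>(1) by blast
qed

lemma value_at_kernel:
  assumes \<phi>: "\<phi> \<in> hermitian.characters"
  shows "value_at A x (gelfand_kernel \<phi>) = gelfand \<phi> x"
  unfolding value_at_def
  by (rule the_equality)
    (simp_all add: gelfand_kernel_def linear_diff[OF linear_gelfand[OF \<phi>]] gelfand_lscale[OF \<phi>] gelfand_unit[OF \<phi>]
      gen0_right)

lemma topspace_spectrum: "topspace (spectrum_topology A) = maximal_ideals A"
  unfolding spectrum_topology_def by auto

lemma continuous_value_at: "continuous_map (spectrum_topology A) euclidean (value_at A x)"
proof -
  have "openin (spectrum_topology A) {M \<in> maximal_ideals A. value_at A x M \<in> U}" if "open U" for U
    unfolding spectrum_topology_def using that by (intro topology_generated_by_Basis) blast
  then show ?thesis by (simp add: continuous_map_def topspace_spectrum)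
qed

text \<open>Lets a continuous function on the spectrum be pulled back to the compact Hausdorff space of
  characters, where Stone-Weierstrass applies.\<close>

lemma continuous_kernel:
  "continuous_map (top_of_set hermitian.characters) (spectrum_topology A) gelfand_kernel"
  unfolding spectrum_topology_def
proof (rule continuous_on_generated_topo)
  fix W assume "W \<in> {{M \<in> maximal_ideals A. value_at A x M \<in> U} | x U. open U}"
  then obtain x U where W: "W = {M \<in> maximal_ideals A. value_at A x M \<in> U}" "open U" by blast
  have "gelfand_kernel -` W \<inter> hermitian.characters = hermitian.characters \<inter> (\<lambda>\<phi>. gelfand \<phi> x) -` U"
    using kernel_maximal value_at_kernel by (auto simp: W)
  moreover have "continuous_on UNIV (\<lambda>\<phi>. gelfand \<phi> x)"
    unfolding gelfand_def by (intro continuous_intros continuous_on_product_coordinates)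
  ultimately show "openin (top_of_set hermitian.characters)
      (gelfand_kernel -` W \<inter> topspace (top_of_set hermitian.characters))"
    using W(2) by (simp add: open_vimage openin_open_Int)
next
  show "gelfand_kernel ` topspace (top_of_set hermitian.characters) \<subseteq>
      \<Union> {{M \<in> maximal_ideals A. value_at A x M \<in> U} | x U. open U}"
    using topspace_spectrum kernel_maximal
    unfolding spectrum_topology_def topology_generated_by_topspace by auto
qed

text \<open>Each of the \<open>m + 1\<close> real coordinates of \<open>f\<close> is a continuous function of the character and is
  therefore given by a hermitian element, the coefficient of \<open>i\<^sub>j\<close>.\<close>

lemma represents_continuous_function:
  assumes f: "continuous_map (spectrum_topology A) euclidean f"
  shows "\<exists>x. \<forall>M\<in>maximal_ideals A. value_at A x M = f M"
proof -
  have "continuous_map (top_of_set hermitian.characters) euclidean (f \<circ> gelfand_kernel)"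
    by (rule continuous_map_compose[OF continuous_kernel f])
  then have cont: "continuous_on hermitian.characters (\<lambda>\<phi>. f (gelfand_kernel \<phi>) \<bullet> \<ii> j)" for j
    by (intro continuous_intros) (simp add: o_def)
  have "\<exists>c\<in>hermitian. \<forall>\<phi>\<in>hermitian.characters. \<phi> c = f (gelfand_kernel \<phi>) \<bullet> \<ii> j" for j
    by (rule hermitian.continuous_function_represented[OF cont])
  then obtain c where c: "\<And>j. c j \<in> hermitian"
    "\<And>j \<phi>. \<phi> \<in> hermitian.characters \<Longrightarrow> \<phi> (c j) = f (gelfand_kernel \<phi>) \<bullet> \<ii> j"
    by metis
  define x where "x = (\<Sum>j\<le>m. c j \<odot> \<ii> j)"
  have "value_at A x M = f M" if M: "M \<in> maximal_ideals A" for M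
  proof -
    obtain \<phi> where \<phi>: "\<phi> \<in> hermitian.characters" "M = gelfand_kernel \<phi>"
      using maximal_ideal_is_kernel[OF M] by blast
    have "value_at A x M = (\<Sum>j\<le>m. \<phi> (c j) *\<^sub>R \<ii> j)"
      using c(1) by (simp add: \<phi>(2) value_at_kernel[OF \<phi>(1)] x_def
          linear_sum[OF linear_gelfand[OF \<phi>(1)]] gelfand_rscale[OF \<phi>(1)])
    then show ?thesis by (simp add: c(2)[OF \<phi>(1)] gen_expansion \<phi>(2))
  qed
  then show ?thesis by blast
qed

theorem isometrically_star_isomorphic:
  "isometrically_star_isomorphic_to_C K A (spectrum_topology A)"
proof -
  define \<Phi> where "\<Phi> x = restrict (value_at A x) (maximal_ideals A)" for x
  have \<Phi>_kernel: "\<Phi> x (gelfand_kernel \<phi>) = gelfand \<phi> x" if "\<phi> \<in> hermitian.characters" for x \<phi>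
    using kernel_maximal[OF that] value_at_kernel[OF that] by (simp add: \<Phi>_def)
  have spectrum: "maximal_ideals A = gelfand_kernel ` hermitian.characters"
    using kernel_maximal maximal_ideal_is_kernel by blast
  have norm: "bdd_above ((\<lambda>M. norm (\<Phi> x M)) ` maximal_ideals A) \<and>
      norm x = (SUP M\<in>maximal_ideals A. norm (\<Phi> x M))" for x
  proof -
    have image: "(\<lambda>M. norm (\<Phi> x M)) ` maximal_ideals A = (\<lambda>\<phi>. norm (gelfand \<phi> x)) ` hermitian.characters"
      unfolding spectrum by (auto simp: \<Phi>_kernel image_image cong: image_cong)
    have "norm x \<in> (\<lambda>\<phi>. norm (gelfand \<phi> x)) ` hermitian.characters"
      using norm_gelfand_attained[of x] by force
    then show ?thesis
      unfolding image using norm_gelfand_le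
      by (auto intro!: cSup_eq_maximum[symmetric] bdd_aboveI2)
  qed
  have "inj \<Phi>"
  proof (rule injI)
    fix x y assume eq: "\<Phi> x = \<Phi> y"
    obtain \<phi> where \<phi>: "\<phi> \<in> hermitian.characters" "norm (gelfand \<phi> (x - y)) = norm (x - y)"
      using norm_gelfand_attained by blast
    have "gelfand \<phi> (x - y) = 0"
      using \<Phi>_kernel[OF \<phi>(1), of x] \<Phi>_kernel[OF \<phi>(1), of y] eq
      by (simp add: linear_diff[OF linear_gelfand[OF \<phi>(1)]])
    then show "x = y" using \<phi>(2) by simp
  qed
  moreover have "range \<Phi> = continuous_functions (spectrum_topology A)"
  proof
    have "continuous_map (spectrum_topology A) euclidean (\<Phi> x)" for x
      using continuous_value_at[of x] by (rule continuous_map_eq) (simp add: \<Phi>_def topspace_spectrum)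
    then show "range \<Phi> \<subseteq> continuous_functions (spectrum_topology A)"
      by (auto simp: continuous_functions_def topspace_spectrum) (simp add: \<Phi>_def)
    show "continuous_functions (spectrum_topology A) \<subseteq> range \<Phi>"
    proof
      fix f :: "'a set \<Rightarrow> 'k" assume "f \<in> continuous_functions (spectrum_topology A)"
      then have f: "continuous_map (spectrum_topology A) euclidean f" "f \<in> extensional (maximal_ideals A)"
        by (auto simp: continuous_functions_def topspace_spectrum)
      obtain x where "\<And>M. M \<in> maximal_ideals A \<Longrightarrow> value_at A x M = f M"
        using represents_continuous_function[OF f(1)] by blast
      then have "\<Phi> x = f" using f(2) by (intro extensionalityI[of _ "maximal_ideals A"]) (auto simp: \<Phi>_def)
      then show "f \<in> range \<Phi>" by blast
    qed
  qed
  ultimately have "bij_betw \<Phi> UNIV (continuous_functions (spectrum_topology A))"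
    by (simp add: bij_betw_def)
  moreover have "(\<forall>x y. \<Phi> (x + y) M = \<Phi> x M + \<Phi> y M) \<and>
      (\<forall>a x. \<Phi> (lscale A a x) M = smult K a (\<Phi> x M)) \<and>
      (\<forall>a x. \<Phi> (x \<odot> a) M = smult K (\<Phi> x M) a) \<and>
      (\<forall>x y. \<Phi> (x \<cdot> y) M = smult K (\<Phi> x M) (\<Phi> y M)) \<and>
      \<Phi> e M = \<ii> 0 \<and> (\<forall>x. \<Phi> (x\<^sup>\<dagger>) M = sconj K (\<Phi> x M))" if M: "M \<in> maximal_ideals A" for M
  proof -
    obtain \<phi> where \<phi>: "\<phi> \<in> hermitian.characters" "M = gelfand_kernel \<phi>"
      using maximal_ideal_is_kernel[OF M] by blast
    show ?thesis
      by (simp add: \<phi>(2) \<Phi>_kernel[OF \<phi>(1)] linear_add[OF linear_gelfand[OF \<phi>(1)]] gelfand_lscale[OF \<phi>(1)]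
          gelfand_rscale_general[OF \<phi>(1)] gelfand_amult[OF \<phi>(1)] gelfand_unit[OF \<phi>(1)] gelfand_star[OF \<phi>(1)])
  qed
  ultimately show ?thesis
    unfolding isometrically_star_isomorphic_to_C_def topspace_spectrum using norm by blast
qed

end

theorem mainTheorem2:
  shows "(\<forall>A :: (quaternion, 'a::banach) star_algebra.
           scalar_cstar_algebra Quat A \<and> quasicommutative Quat A \<longrightarrow>
             isometrically_star_isomorphic_to_C Quat A (spectrum_topology A)) \<and>
         (\<forall>A :: (octonion, 'b::banach) star_algebra.
           scalar_cstar_algebra Oct A \<and> quasicommutative Oct A \<longrightarrow>
             isometrically_star_isomorphic_to_C Oct A (spectrum_topology A))"
  by (intro conjI allI impI; elim conjE;
      intro quasicommutative_cstar_algebra.isometrically_star_isomorphic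
        quasicommutative_cstar_algebra.intro quasicommutative_cstar_algebra_axioms.intro
        conjugation_algebra_Quat conjugation_algebra_Oct)

end
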